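(* Let $a$ be any real number with $a\neq 1/2$. For non-negative integers $n$ put $$k_{n,a}=\sum_{\rho}\left(1-\left(\frac{\rho-a}{\rho+a-1}\right)^n\right)=\sum_{\rho}\left(1-\left(1-\frac{2a-1}{\rho+a-1}\right)^n\right),$$ where $\rho$ runs over the zeroes of the Riemann xi-function, counted with multiplicity. Then the Riemann hypothesis is equivalent to the statement that $k_{n,a}\ge 0$ for every non-negative integer $n$.
   Context: The Riemann xi-function is the entire function $\xi(z)=\frac12 z(z-1)\pi^{-z/2}\Gamma(z/2)\zeta(z)$ (removable singularities removed), where $\zeta$ is the Riemann zeta-function; its zeroes are exactly the non-trivial zeroes of $\zeta$. The Riemann hypothesis is the statement that every zero $\rho$ of $\xi$ satisfies $\operatorname{Re}\rho=1/2$. Sums over zeroes $\rho$ are taken with multiplicity, and contributions of complex conjugate zeroes are paired when summing, i.e. $\sum_\rho$ means $\lim_{T\to\infty}\sum_{|\operatorname{Im}\rho|\le T}$. *)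

theory Defs
  imports "HOL-Complex_Analysis.Complex_Analysis" "HOL-Library.Complex_Order"
begin

(* The analytic continuation to the punctured plane of the Dirichlet series, unique by the
   identity theorem. The value at the pole is normalised to 0 only to make the function unique. *)
definition riemann_zeta :: "complex \<Rightarrow> complex" where
  "riemann_zeta = (THE f. f holomorphic_on (- {1}) \<and>
     (\<forall>s. Re s > 1 \<longrightarrow> (\<lambda>n. 1 / of_nat (Suc n) powr s) sums f s) \<and> f 1 = 0)"

(* The product has removable singularities at 1 and at the poles 0, -2, -4, ... of Gamma (z/2);
   Isabelle's totalised values there are replaced by the limits. *)
definition riemann_xi :: "complex \<Rightarrow> complex" where
  "riemann_xi = remove_sings (\<lambda>z. 1 / 2 * z * (z - 1) * of_real pi powr (- z / 2)
     * Gamma (z / 2) * riemann_zeta z)"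

definition riemann_hypothesis :: bool where
  "riemann_hypothesis \<longleftrightarrow> (\<forall>\<rho>. riemann_xi \<rho> = 0 \<longrightarrow> Re \<rho> = 1 / 2)"

(* Partial sum over the zeroes of height at most T; zorder is the multiplicity of the zero. *)
definition xi_zeros_partial_sum :: "(complex \<Rightarrow> complex) \<Rightarrow> real \<Rightarrow> complex" where
  "xi_zeros_partial_sum f T =
     (\<Sum>\<rho> | riemann_xi \<rho> = 0 \<and> \<bar>Im \<rho>\<bar> \<le> T. of_int (zorder riemann_xi \<rho>) * f \<rho>)"

definition has_xi_zeros_sum :: "(complex \<Rightarrow> complex) \<Rightarrow> complex \<Rightarrow> bool" where
  "has_xi_zeros_sum f S \<longleftrightarrow> (xi_zeros_partial_sum f \<longlongrightarrow> S) at_top"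

definition xi_zeros_sum :: "(complex \<Rightarrow> complex) \<Rightarrow> complex" where
  "xi_zeros_sum f = Lim at_top (xi_zeros_partial_sum f)"

definition li_coeff :: "nat \<Rightarrow> real \<Rightarrow> complex" where
  "li_coeff n a =
     xi_zeros_sum (\<lambda>\<rho>. 1 - ((\<rho> - of_real a) / (\<rho> + of_real a - 1)) ^ n)"

end

theory Submission
  imports Defs "HOL-Probability.Characteristic_Functions" "HOL-Analysis.Kronecker_Approximation_Theorem"
begin

text \<open>
  Write \<open>w \<rho> = (\<rho> - a) / (\<rho> + a - 1)\<close>. This Moebius transformation maps the critical line to the unit circle,
  tends to \<open>1\<close> at infinity, and turns the symmetry \<open>\<rho> \<mapsto> 1 - \<rho>\<close> of the zeros into \<open>w \<mapsto> 1 / w\<close>.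
  Conjugate zeros have conjugate values, so \<open>k\<^sub>n\<^sub>,\<^sub>a\<close> is the sum of the real numbers \<open>Re (1 - w \<rho> ^ n)\<close>.
  
  If all zeros lie on the critical line, then \<open>norm (w \<rho>) = 1\<close> and every term is nonnegative. If
  some zero lies off the line, then it or its mirror image has \<open>norm (w \<rho>) > 1\<close>. Because \<open>w \<rho>\<close> tends to \<open>1\<close>
  along the zeros, the maximal modulus \<open>R > 1\<close> is attained by finitely many zeros and all others satisfy
  \<open>norm (w \<rho>) \<le> r\<close> for some \<open>r < R\<close>. By Dirichlet's simultaneous approximation theorem there are arbitrarily large
  \<open>n\<close> for which all the maximal values \<open>w \<rho> ^ n\<close> have real part at least \<open>R ^ n / 2\<close>. For such \<open>n\<close> the maximal
  zeros contribute a negative amount of order \<open>R ^ n\<close>, the others only \<open>O(n\<^sup>2 * r ^ n)\<close>, and the sum is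
  negative (\<open>li_sum_negative\<close>).
  
  The convergence of the sums and the bound \<open>O(n\<^sup>2 * r ^ n)\<close> have the same source. With \<open>u = 1 - w \<rho>\<close> one
  has \<open>1 - w \<rho> ^ n = n * u + O(n\<^sup>2 * (norm u)\<^sup>2 * r ^ n)\<close>, where \<open>norm u = O(1 / norm \<rho>)\<close> and, because the
  zeros lie in a vertical strip, \<open>Re u = O(1 / (norm \<rho>)\<^sup>2)\<close>. So everything follows from the convergence of the
  sum of \<open>1 / (1 + norm \<rho>)\<^sup>2\<close> over the zeros with multiplicity (\<open>summable_xi_zeros\<close>), and this from a Jensen-type
  inequality and a bound on the growth of the xi-function.
  
  The facts about the xi-function come from Riemann's integral representation
  \<open>\<xi>(s) = 1 / 2 + s * (s - 1) * integral {0..} (\<lambda>u. (exp (s * u) + exp ((1 - s) * u)) * psi u)\<close>, where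
  \<open>psi\<close> is the theta series in a logarithmic variable. It shows at once that \<open>\<xi>\<close> is entire, symmetric
  under \<open>s \<mapsto> 1 - s\<close> and conjugation, free of real zeros, and of growth at most \<open>exp (O(r * ln r))\<close>. The
  representation itself rests on the transformation formula of the theta function
  (\<open>theta_transformation\<close>), that is, on Poisson summation for Gaussians; dividing it by the Gamma factor also
  constructs the analytic continuation of the zeta-function (\<open>riemann_zeta_eq\<close>).
\<close>

section \<open>The transformation formula of the theta function\<close>

text \<open>
  The substitution \<open>u = sqrt (2 * pi * x) * t\<close> turns the integral into the characteristic
  function of the standard normal distribution.
\<close>
lemma gaussian_fourier_transform:
  fixes x y :: real
  assumes x: "x > 0"
  shows "integrable lborel (\<lambda>t. exp (- of_real (pi * x) * (of_real t)\<^sup>2) * exp (- 2 * of_real pi * \<i> * of_real y * of_real t))" (is "integrable _ ?f")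
    and "(LINT t|lborel. exp (- of_real (pi * x) * (of_real t)\<^sup>2) * exp (- 2 * of_real pi * \<i> * of_real y * of_real t))
           = of_real (exp (- pi * y\<^sup>2 / x) / sqrt x)"
proof -
  define c where "c = sqrt (2 * pi * x)"
  have c: "c > 0" "c\<^sup>2 = 2 * pi * x" using x by (simp_all add: c_def)
  define s where "s = - 2 * pi * y / c"
  define g where "g u = std_normal_density u *\<^sub>R iexp (s * u)" for u
  have g: "g (c * t) = of_real (1 / sqrt (2 * pi)) * ?f t" for t
  proof -
    have 1: "(c * t)\<^sup>2 = 2 * (pi * x * t\<^sup>2)" "s * (c * t) = - 2 * pi * y * t"
      using c by (simp_all add: power_mult_distrib s_def)
    have 2: "(complex_of_real c)\<^sup>2 = 2 * of_real pi * of_real x"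
      using arg_cong[OF c(2), of complex_of_real] by simp
    show ?thesis
      unfolding g_def normal_density_def 1
      by (simp add: scaleR_conv_of_real exp_of_real[symmetric] mult_ac power_mult_distrib 2)
  qed
  have gi: "integrable lborel g"
  proof -
    have "integrable std_normal_distribution (\<lambda>u. iexp (s * u))"
      by (intro prob_space.integrable_iexp real_distribution.axioms(1)[OF real_dist_normal_dist]) auto
    then show ?thesis unfolding g_def by (subst (asm) integrable_density) auto
  qed
  have gv: "(LINT u|lborel. g u) = of_real (exp (- (s^2) / 2))"
  proof -
    have "char std_normal_distribution s = of_real (exp (- (s^2) / 2))"
      by (simp add: char_std_normal_distribution)
    then show ?thesis unfolding g_def char_def by (subst (asm) integral_density) auto
  qed
  have "integrable lborel (\<lambda>t. g (0 + c * t))"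
    using gi c by (subst lborel_integrable_real_affine_iff) auto
  then have "integrable lborel (\<lambda>t. of_real (1 / sqrt (2 * pi)) * ?f t)"
    by (simp add: g)
  then have "integrable lborel (\<lambda>t. of_real (sqrt (2 * pi)) * (of_real (1 / sqrt (2 * pi)) * ?f t))"
    by (rule integrable_mult_right)
  moreover have "complex_of_real (sqrt (2 * pi)) * (of_real (1 / sqrt (2 * pi)) * w) = w" for w
    unfolding mult.assoc[symmetric] of_real_mult[symmetric] by simp
  ultimately show "integrable lborel ?f"
    by (simp only:)
  have "(LINT u|lborel. g u) = \<bar>c\<bar> *\<^sub>R (LINT t|lborel. g (0 + c * t))"
    using c by (intro lborel_integral_real_affine) auto
  also have "\<dots> = of_real (c / sqrt (2 * pi)) * (LINT t|lborel. ?f t)"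
    using c by (simp add: g scaleR_conv_of_real)
  also have "c / sqrt (2 * pi) = sqrt x" by (simp add: c_def real_sqrt_mult)
  also have "s\<^sup>2 / 2 = pi * y\<^sup>2 / x"
    using c x by (simp add: s_def power_divide power_mult_distrib power2_eq_square)
  ultimately show "(LINT t|lborel. ?f t) = of_real (exp (- pi * y\<^sup>2 / x) / sqrt x)"
    using gv x by (simp add: field_simps)
qed

lemma exp_kernel_shift:
  fixes k :: int and n :: int
  shows "exp (- 2 * of_real pi * \<i> * of_int k * (z + of_int n)) = exp (- 2 * of_real pi * \<i> * of_int k * z)"
proof -
  have "exp (- 2 * of_real pi * \<i> * of_int k * (z + of_int n)) 
     = exp (- 2 * of_real pi * \<i> * of_int k * z) * exp (2 * of_int (- k * n) * of_real pi * \<i>)"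
    by (simp add: algebra_simps flip: exp_add)
  also have "exp (2 * of_int (- k * n) * of_real pi * \<i>) = 1"
    using exp_2pi_1_int[of "- k * n"] by (simp only: mult_ac)
  finally show ?thesis by simp
qed

lemma integral_exp_kernel:
  fixes k :: int
  assumes "k \<noteq> 0"
  shows "((\<lambda>t. exp (- 2 * of_real pi * \<i> * of_int k * of_real t)) has_integral 0) {-1/2..1/2::real}"
proof -
  define c where "c = - 2 * of_real pi * \<i> * complex_of_int k"
  have c: "c \<noteq> 0" using assms by (simp add: c_def)
  have "((\<lambda>t. exp (c * of_real t)) has_integral (exp (c * of_real (1/2)) / c - exp (c * of_real (-1/2)) / c)) {-1/2..1/2}"
  proof (intro fundamental_theorem_of_calculus)
    fix t :: real
    have "((\<lambda>z. exp (c * z) / c) has_field_derivative exp (c * of_real t)) (at (of_real t))"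
      using c by (auto intro!: derivative_eq_intros)
    then show "((\<lambda>t. exp (c * of_real t) / c) has_vector_derivative exp (c * of_real t)) (at t within {-1/2..1/2})"
      by (rule has_vector_derivative_real_field)
  qed auto
  also have "exp (c * of_real (1/2)) = exp (c * of_real (-1/2))"
    using exp_kernel_shift[of k "- 1/2" 1] by (simp add: c_def)
  finally show ?thesis by (simp add: c_def)
qed

text \<open>
  Integration by parts against the kernel gains a factor \<open>1 / k\<close>; holomorphy provides
  the bounded derivative on the segment.
\<close>
lemma riemann_lebesgue_holomorphic:
  assumes "H holomorphic_on ball 0 1"
  shows "\<exists>C. \<forall>k::int. k \<noteq> 0 \<longrightarrow>
     norm (integral {-1/2..1/2} (\<lambda>t. H (of_real t) * exp (- 2 * of_real pi * \<i> * of_int k * of_real t))) \<le> C / \<bar>k\<bar>"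
proof -
  let ?e = "\<lambda>k t. exp (- 2 * of_real pi * \<i> * of_int k * of_real t)"
  let ?I = "{-1/2..1/2::real}"
  have sub: "complex_of_real ` ?I \<subseteq> ball 0 1" by auto
  have contH: "continuous_on ?I (\<lambda>t. H (of_real t))"
    by (rule continuous_on_compose2[OF holomorphic_on_imp_continuous_on[OF assms]])
       (use sub in \<open>auto intro!: continuous_intros\<close>)
  have "continuous_on (ball 0 1) (deriv H)"
    using assms by (intro holomorphic_on_imp_continuous_on holomorphic_deriv) auto
  then have contH': "continuous_on ?I (\<lambda>t. deriv H (of_real t))"
    by (rule continuous_on_compose2) (use sub in \<open>auto intro!: continuous_intros\<close>)
  have "compact ((\<lambda>t. H (of_real t)) ` ?I)" "compact ((\<lambda>t. deriv H (of_real t)) ` ?I)"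
    using contH contH' by (auto intro!: compact_continuous_image)
  then have "bounded ((\<lambda>t. H (of_real t)) ` ?I)" "bounded ((\<lambda>t. deriv H (of_real t)) ` ?I)"
    by (auto intro: compact_imp_bounded)
  then obtain B B' where B: "\<And>t. t \<in> ?I \<Longrightarrow> norm (H (of_real t)) \<le> B" "\<And>t. t \<in> ?I \<Longrightarrow> norm (deriv H (of_real t)) \<le> B'"
    unfolding bounded_iff ball_simps by blast
  have "norm (integral ?I (\<lambda>t. H (of_real t) * ?e k t)) \<le> (2 * B + B') / \<bar>k\<bar>" if k: "k \<noteq> 0" for k :: int
  proof -
    define c where "c = - 2 * of_real pi * \<i> * complex_of_int k"
    have c: "c \<noteq> 0" using k by (simp add: c_def)
    have rc: "Re c = 0" by (simp add: c_def)
    have nc: "norm c = 2 * pi * \<bar>k\<bar>" by (simp add: c_def norm_mult)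
    have ne: "norm (exp (c * of_real t)) = 1" for t by (simp add: c_def)
    have D: "((\<lambda>t. H (of_real t) * exp (c * of_real t) / c) has_vector_derivative
          (H (of_real t) * exp (c * of_real t) + deriv H (of_real t) * exp (c * of_real t) / c)) (at t within ?I)" if "t \<in> ?I" for t
    proof -
      have "(H has_field_derivative deriv H (of_real t)) (at (of_real t))"
        using assms sub that by (intro holomorphic_derivI[of _ "ball 0 1"]) auto
      then have "((\<lambda>z. H z * exp (c * z) / c) has_field_derivative
          (H (of_real t) * exp (c * of_real t) + deriv H (of_real t) * exp (c * of_real t) / c)) (at (of_real t))"
        using c by (auto intro!: derivative_eq_intros simp: field_simps)
      then show ?thesis by (rule has_vector_derivative_real_field)
    qed
    have i1: "(\<lambda>t. H (of_real t) * exp (c * of_real t)) integrable_on ?I"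
      by (intro integrable_continuous_interval continuous_intros contH)
    have i2: "(\<lambda>t. deriv H (of_real t) * exp (c * of_real t) / c) integrable_on ?I"
      by (intro integrable_continuous_interval continuous_intros contH') (use c in auto)
    have "((\<lambda>t. H (of_real t) * exp (c * of_real t) + deriv H (of_real t) * exp (c * of_real t) / c) has_integral
            (H (of_real (1/2)) * exp (c * of_real (1/2)) / c - H (of_real (-1/2)) * exp (c * of_real (-1/2)) / c)) ?I"
      by (rule fundamental_theorem_of_calculus) (use D in auto)
    note FTC = this
    have "integral ?I (\<lambda>t. H (of_real t) * exp (c * of_real t)) + integral ?I (\<lambda>t. deriv H (of_real t) * exp (c * of_real t) / c)
        = (H (of_real (1/2)) * exp (c * of_real (1/2)) / c - H (of_real (-1/2)) * exp (c * of_real (-1/2)) / c)"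
      unfolding integral_add[OF i1 i2, symmetric] by (rule integral_unique[OF FTC])
    then have eq: "integral ?I (\<lambda>t. H (of_real t) * exp (c * of_real t)) = 
        H (of_real (1/2)) * exp (c * of_real (1/2)) / c - H (of_real (-1/2)) * exp (c * of_real (-1/2)) / c 
        - integral ?I (\<lambda>t. deriv H (of_real t) * exp (c * of_real t) / c)"
      by (simp add: algebra_simps)
    have n1: "norm (integral ?I (\<lambda>t. deriv H (of_real t) * exp (c * of_real t) / c)) \<le> B' / norm c * (1/2 - (-1/2))"
    proof (rule integral_bound)
      show "continuous_on ?I (\<lambda>t. deriv H (of_real t) * exp (c * of_real t) / c)"
        by (intro continuous_intros contH') (use c in auto)
    qed (use B(2) rc c in \<open>auto simp: norm_mult norm_divide intro!: divide_right_mono\<close>)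
    have n2: "norm (H (of_real t) * exp (c * of_real t) / c) \<le> B / norm c" if "t \<in> ?I" for t
      using B(1)[OF that] rc c by (auto simp: norm_mult norm_divide intro!: divide_right_mono)
    have "norm (integral ?I (\<lambda>t. H (of_real t) * exp (c * of_real t))) \<le> B / norm c + B / norm c + B' / norm c"
      unfolding eq using n1 by (intro order_trans[OF norm_triangle_ineq4] add_mono n2) auto
    also have "\<dots> = (2 * B + B') / (2 * pi * \<bar>k\<bar>)" unfolding nc by (simp add: add_divide_distrib)
    also have "\<dots> \<le> (2 * B + B') / \<bar>k\<bar>"
    proof (rule divide_left_mono)
      show "real_of_int \<bar>k\<bar> \<le> 2 * pi * real_of_int \<bar>k\<bar>"
        using mult_right_mono[of 1 "2 * pi" "real_of_int \<bar>k\<bar>"] pi_gt3 by simp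
      have "0 \<le> B" "0 \<le> B'" using B(1)[of 0] B(2)[of 0] norm_ge_zero order_trans by (auto, blast+)
      then show "0 \<le> 2 * B + B'" by simp
    qed (use k in auto)
    finally show ?thesis by (simp add: c_def)
  qed
  then show ?thesis by blast
qed

text \<open>
  Chernoff's proof that a Fourier series converges at a point of smoothness. In the unit disc
  \<open>exp (2 * pi * \<i> * z) - 1\<close> has only the simple zero \<open>z = 0\<close>, so it divides \<open>F z - F 0\<close>. The
  coefficients of \<open>F - F 0\<close> are therefore differences of consecutive coefficients of the quotient,
  the symmetric partial sums telescope, and the Riemann--Lebesgue lemma removes the two end terms.
\<close>
lemma fourier_coeffs_sums_at_0:
  assumes F: "F holomorphic_on ball 0 1"
  defines "c \<equiv> \<lambda>k::int. integral {-1/2..1/2::real} (\<lambda>t. F (of_real t) * exp (- 2 * of_real pi * \<i> * of_int k * of_real t))"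
  shows "(\<lambda>n. c (int (Suc n)) + c (- int (Suc n))) sums (F 0 - c 0)"
proof -
  let ?I = "{-1/2..1/2::real}"
  let ?e = "\<lambda>k t. exp (- 2 * of_real pi * \<i> * of_int k * of_real t) :: complex"
  define E where "E z = exp (2 * of_real pi * \<i> * z)" for z
  define P where "P f z = (if z = 0 then deriv f 0 else (f z - f 0) / (z - 0))" for f :: "complex \<Rightarrow> complex" and z
  have PF: "P F holomorphic_on ball 0 1" and PE: "P E holomorphic_on ball 0 1"
    unfolding P_def using F by (auto intro!: pole_lemma holomorphic_intros simp: E_def[abs_def])
  have "(E has_field_derivative 2 * of_real pi * \<i>) (at 0)"
    unfolding E_def by (auto intro!: derivative_eq_intros)
  then have dE: "deriv E 0 = 2 * of_real pi * \<i>" by (rule DERIV_imp_deriv)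
  have PE0: "P E z \<noteq> 0" if "z \<in> ball 0 1" for z
  proof (cases "z = 0")
    case False
    have "E z \<noteq> 1"
    proof
      assume "E z = 1"
      then obtain n :: int where n: "Re (2 * of_real pi * \<i> * z) = 0" "Im (2 * of_real pi * \<i> * z) = of_int (2 * n) * pi"
        unfolding E_def exp_eq_1 by blast
      then have z: "Im z = 0" "Re z = of_int n" by auto
      then have "z = of_int n" by (simp add: complex_eq_iff)
      with that have "\<bar>n\<bar> < 1" by simp
      with z False show False by (simp add: complex_eq_iff)
    qed
    then show ?thesis using False by (simp add: P_def E_def)
  qed (simp add: P_def dE)
  \<comment> \<open>The difference quotients at \<open>0\<close> cancel the common zero; in the disc only \<open>z = 0\<close> makes \<open>E z = 1\<close>.\<close>
  define H where "H z = P F z / P E z" for z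
  have holH: "H holomorphic_on ball 0 1"
    unfolding H_def using PF PE PE0 by (intro holomorphic_intros) auto
  have FH: "F z - F 0 = H z * (E z - 1)" if "z \<in> ball 0 1" for z
    using PE0[OF that] by (cases "z = 0") (auto simp: H_def P_def E_def)
  define h where "h k = integral ?I (\<lambda>t. H (of_real t) * ?e k t)" for k :: int
  have cont: "continuous_on ?I (\<lambda>t. H (of_real t))" "continuous_on ?I (\<lambda>t. F (of_real t))"
    by (rule continuous_on_compose2[OF holomorphic_on_imp_continuous_on[OF holH]]
             continuous_on_compose2[OF holomorphic_on_imp_continuous_on[OF F]];
        auto intro!: continuous_intros)+
  have intH: "(\<lambda>t. H (of_real t) * ?e k t) integrable_on ?I" for k
    by (intro integrable_continuous_interval continuous_intros cont)
  \<comment> \<open>Multiplication by \<open>E\<close> shifts the index of a Fourier coefficient by one.\<close>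
  have step: "c k = (if k = 0 then F 0 else 0) + (h (k - 1) - h k)" for k
  proof -
    have 1: "((\<lambda>t. F 0 * ?e k t) has_integral (if k = 0 then F 0 else 0)) ?I"
    proof (cases "k = 0")
      case True
      then show ?thesis using has_integral_const_real[of "F 0" "-1/2" "1/2"] by simp
    next
      case False
      then show ?thesis using has_integral_mult_right[OF integral_exp_kernel[OF False], of "F 0"] by simp
    qed
    have "F (of_real t) * ?e k t = F 0 * ?e k t + (H (of_real t) * ?e (k - 1) t - H (of_real t) * ?e k t)" if "t \<in> ?I" for t
    proof -
      have "E (of_real t) * ?e k t = ?e (k - 1) t"
        by (simp add: E_def algebra_simps flip: exp_add)
      moreover have "complex_of_real t \<in> ball 0 1" using that by (auto simp: abs_if)
      from FH[OF this] have "F (of_real t) = F 0 + H (of_real t) * (E (of_real t) - 1)"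
        by (simp add: algebra_simps)
      then have "F (of_real t) * ?e k t = F 0 * ?e k t + (H (of_real t) * (E (of_real t) * ?e k t) - H (of_real t) * ?e k t)"
        by (simp only:) (simp add: algebra_simps)
      ultimately show ?thesis by simp
    qed
    then have "c k = integral ?I (\<lambda>t. F 0 * ?e k t + (H (of_real t) * ?e (k - 1) t - H (of_real t) * ?e k t))"
      unfolding c_def by (rule integral_cong)
    also have "\<dots> = (if k = 0 then F 0 else 0) + (h (k - 1) - h k)"
      unfolding h_def by (intro integral_unique has_integral_add has_integral_diff 1 integrable_integral intH)
    finally show ?thesis .
  qed
  obtain C where C: "\<And>k. k \<noteq> 0 \<Longrightarrow> norm (h k) \<le> C / \<bar>k\<bar>"
    using riemann_lebesgue_holomorphic[OF holH] unfolding h_def[symmetric] by auto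
  have h1: "(\<lambda>n. h (int n)) \<longlonglongrightarrow> 0"
  proof (rule Lim_null_comparison)
    show "\<forall>\<^sub>F n in sequentially. norm (h (int n)) \<le> C * (1 / real n)"
      using eventually_gt_at_top[of 0]
    proof eventually_elim
      fix n :: nat assume "n > 0"
      then show "norm (h (int n)) \<le> C * (1 / real n)" using C[of "int n"] by simp
    qed
    show "(\<lambda>n. C * (1 / real n)) \<longlonglongrightarrow> 0"
      using tendsto_mult[OF tendsto_const lim_1_over_n] by simp
  qed
  have h2: "(\<lambda>n. h (- 1 - int n)) \<longlonglongrightarrow> 0"
  proof (rule Lim_null_comparison)
    show "\<forall>\<^sub>F n in sequentially. norm (h (- 1 - int n)) \<le> C * inverse (real (Suc n))"
    proof (rule always_eventually, rule allI)
      fix n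
      show "norm (h (- 1 - int n)) \<le> C * inverse (real (Suc n))"
        using C[of "- 1 - int n"] by (simp add: divide_inverse abs_if add.commute)
    qed
    show "(\<lambda>n. C * inverse (real (Suc n))) \<longlonglongrightarrow> 0"
      using tendsto_mult[OF tendsto_const LIMSEQ_inverse_real_of_nat] by simp
  qed
  have "(\<Sum>n<N. c (int (Suc n)) + c (- int (Suc n))) = h 0 - h (-1) - (h (int N) - h (- 1 - int N))" for N
    by (induction N) (auto simp: step algebra_simps)
  moreover have "(\<lambda>N. h 0 - h (-1) - (h (int N) - h (- 1 - int N))) \<longlonglongrightarrow> h 0 - h (-1) - (0 - 0)"
    by (intro tendsto_intros h1 h2)
  moreover have "h 0 - h (-1) - (0 - 0) = F 0 - c 0" using step[of 0] by simp
  ultimately show ?thesis unfolding sums_def by simp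
qed

text \<open>
  Poisson summation for a Gaussian \<open>f\<close>. The periodisation \<open>F z = (\<Sum>n. f (z + n))\<close> over all integers
  has as Fourier coefficients over one period the Fourier transform of \<open>f\<close> on the whole line, and the
  previous lemma evaluates \<open>F 0\<close>. The integers are enumerated as \<open>0\<close> and then the pairs
  \<open>n, - n\<close>, so that all series are indexed by natural numbers and the partial sums unfold to
  integrals over the symmetric intervals \<open>[- N - 1/2, N + 1/2]\<close>.
\<close>
lemma theta_transformation:
  fixes x :: real
  assumes x: "x > 0"
  shows "1 + 2 * (\<Sum>n. exp (- pi * (Suc n)\<^sup>2 * x)) = (1 + 2 * (\<Sum>n. exp (- pi * (Suc n)\<^sup>2 / x))) / sqrt x"
proof -
  define f :: "complex \<Rightarrow> complex" where "f z = exp (- of_real (pi * x) * z\<^sup>2)" for z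
  define g where "g n z = (if n = 0 then f z else f (z + of_nat n) + f (z - of_nat n))" for n z
  \<comment> \<open>In the unit disc \<open>Re ((z + n)\<^sup>2) \<ge> \<bar>n\<bar> - 3\<close>, which gives a geometric majorant.\<close>
  define M where "M n = 2 * exp (3 * pi * x) * exp (- pi * x) ^ n" for n :: nat
  have sumM: "summable M"
    unfolding M_def using x by (intro summable_mult summable_geometric) auto
  have nf: "norm (f w) \<le> exp (3 * pi * x) * exp (- pi * x) ^ n"
    if "\<bar>Im w\<bar> \<le> 1" "(Re w)\<^sup>2 \<ge> real n - 2" for w n
  proof -
    have "(Im w)\<^sup>2 \<le> 1" using that(1) by (simp add: abs_square_le_1)
    then have "real n - 3 \<le> (Re w)\<^sup>2 - (Im w)\<^sup>2" using that(2) by linarith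
    then have "pi * x * (real n - 3) \<le> pi * x * ((Re w)\<^sup>2 - (Im w)\<^sup>2)"
      using x by (intro mult_left_mono) auto
    then have "norm (f w) \<le> exp (- (pi * x * (real n - 3)))"
      by (simp add: f_def Re_power2)
    also have "\<dots> = exp (3 * pi * x) * exp (- pi * x) ^ n"
      by (simp add: algebra_simps flip: exp_of_nat_mult exp_add)
    finally show ?thesis .
  qed
  have sq: "(a + b)\<^sup>2 \<ge> real n - 2" if "\<bar>a\<bar> \<le> 1" "\<bar>b\<bar> = real n" for a b :: real and n
  proof (cases "n = 0")
    case False
    have "\<bar>a + b\<bar> \<ge> real n - 1" using that by linarith
    then have "(a + b)\<^sup>2 \<ge> (real n - 1)\<^sup>2"
      using False power_mono[of "real n - 1" "\<bar>a + b\<bar>" 2] by simp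
    moreover have "(real n - 1)\<^sup>2 - (real n - 2) = (real n - 3/2)\<^sup>2 + 3/4" by (simp add: power2_eq_square algebra_simps)
    ultimately show ?thesis using zero_le_power2[of "real n - 3/2"] by linarith
  qed (auto intro: order_trans[OF _ zero_le_power2])
  have bound: "norm (g n z) \<le> M n" if z: "z \<in> ball 0 1" for n z
  proof -
    have "\<bar>Re z\<bar> \<le> 1" "\<bar>Im z\<bar> \<le> 1"
      using z abs_Re_le_cmod[of z] abs_Im_le_cmod[of z] by auto
    then have "norm (f (z + of_int k)) \<le> exp (3 * pi * x) * exp (- pi * x) ^ n" if "\<bar>k\<bar> = int n" for k
      using that by (intro nf) (auto intro!: sq)
    from this[of "int n"] this[of "- int n"] show ?thesis
      using norm_triangle_ineq[of "f (z + of_nat n)" "f (z - of_nat n)"]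
      by (cases "n = 0") (auto simp: g_def M_def intro: order_trans[of _ "exp (3 * pi * x)"])
  qed
  define F where "F z = (\<Sum>n. g n z)" for z
  have uni: "uniform_limit (ball 0 1) (\<lambda>N z. \<Sum>n<N. g n z) F sequentially"
    unfolding F_def by (rule Weierstrass_m_test[OF bound sumM])
  have holg: "g n holomorphic_on A" for n A
    by (cases "n = 0") (auto simp: g_def[abs_def] f_def intro!: holomorphic_intros)
  have holF: "F holomorphic_on ball 0 1"
  proof (rule holomorphic_uniform_sequence)
    show "(\<lambda>z. \<Sum>n<N. g n z) holomorphic_on ball 0 1" for N
      by (intro holomorphic_intros holg)
    fix z :: complex assume "z \<in> ball 0 1"
    then obtain d where d: "0 < d" "cball z d \<subseteq> ball 0 1"
      by (meson open_ball open_contains_cball)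
    then show "\<exists>d>0. cball z d \<subseteq> ball 0 1 \<and> uniform_limit (cball z d) (\<lambda>N z. \<Sum>n<N. g n z) F sequentially"
      using uniform_limit_on_subset[OF uni] by blast
  qed auto
  let ?I = "{-1/2..1/2::real}"
  let ?e = "\<lambda>(k::int) t. exp (- 2 * of_real pi * \<i> * of_int k * of_real t) :: complex"
  define c where "c k = integral ?I (\<lambda>t. F (of_real t) * ?e k t)" for k
  have c: "c k = of_real (exp (- pi * (of_int k)\<^sup>2 / x) / sqrt x)" for k
  proof -
    let ?h = "\<lambda>t. f (of_real t) * ?e k t"
    have conth: "continuous_on A ?h" for A
      unfolding f_def by (intro continuous_intros)
    have inth: "?h integrable_on {a..b}" for a b
      by (intro integrable_continuous_interval conth)
    have contg: "continuous_on A (\<lambda>t. g n (of_real t) * ?e k t)" for n A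
      by (cases "n = 0") (auto simp: g_def f_def intro!: continuous_intros)
    have ulim: "uniform_limit ?I (\<lambda>N t. \<Sum>n<N. g n (of_real t) * ?e k t) (\<lambda>t. \<Sum>n. g n (of_real t) * ?e k t) sequentially"
    proof (rule Weierstrass_m_test[OF _ sumM])
      fix n and t :: real assume "t \<in> ?I"
      then have "complex_of_real t \<in> ball 0 1" by (auto simp: abs_if)
      from bound[OF this, of n] show "norm (g n (of_real t) * ?e k t) \<le> M n" by (simp add: norm_mult)
    qed
    obtain I J where IJ: "\<And>N. ((\<lambda>t. \<Sum>n<N. g n (of_real t) * ?e k t) has_integral I N) ?I"
      "((\<lambda>t. \<Sum>n. g n (of_real t) * ?e k t) has_integral J) ?I" "I \<longlonglongrightarrow> J"
    proof (rule uniform_limit_integral[OF ulim])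
      show "continuous_on ?I (\<lambda>t. \<Sum>n<N. g n (of_real t) * ?e k t)" for N
        by (intro continuous_on_sum contg)
    qed auto
    have "c k = integral ?I (\<lambda>t. \<Sum>n. g n (of_real t) * ?e k t)"
      unfolding c_def
    proof (rule integral_cong)
      fix t :: real assume "t \<in> ?I"
      then have "complex_of_real t \<in> ball 0 1" by (auto simp: abs_if)
      then have "summable (\<lambda>n. g n (of_real t))"
        using bound sumM by (intro summable_comparison_test[OF _ sumM]) auto
      then show "F (of_real t) * ?e k t = (\<Sum>n. g n (of_real t) * ?e k t)"
        unfolding F_def by (rule suminf_mult2)
    qed
    also have "\<dots> = J" using IJ(2) by (rule integral_unique)
    finally have cJ: "c k = J" .
    have shift: "integral ?I (\<lambda>t. f (of_real t + of_int m) * ?e k t) = integral {of_int m - 1/2..of_int m + 1/2} ?h" for m :: int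
    proof -
      have "integral {(of_int m - 1/2) - of_int m..(of_int m + 1/2) - of_int m} (\<lambda>t. ?h (t + of_int m)) = integral {of_int m - 1/2..of_int m + 1/2} ?h"
        by (rule integral_shift_real_ivl)
      moreover have "?h (t + of_int m) = f (of_real t + of_int m) * ?e k t" for t
        using exp_kernel_shift[of k "of_real t" m] by simp
      moreover have "(of_int m - 1/2) - of_int m = (- 1/2::real)" "(of_int m + 1/2) - of_int m = (1/2::real)" by simp_all
      ultimately show ?thesis by (simp only:)
    qed
    define K where "K a b = integral {a..b} ?h" for a b
    have comb: "K a b + K b c = K a c" if "a \<le> b" "b \<le> c" for a b c
      unfolding K_def using that by (intro Henstock_Kurzweil_Integration.integral_combine inth)
    have I: "I (Suc N) = integral {- real N - 1/2..real N + 1/2} ?h" for N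
    proof -
      have "I (Suc N) = (\<Sum>n<Suc N. integral ?I (\<lambda>t. g n (of_real t) * ?e k t))"
        by (rule has_integral_unique[OF IJ(1)])
          (intro has_integral_sum integrable_integral integrable_continuous_interval contg finite_lessThan)
      also have "\<dots> = integral {- real N - 1/2..real N + 1/2} ?h"
      proof (induction N)
        case 0
        show ?case by (simp add: g_def)
      next
        case (Suc N)
        have i: "(\<lambda>t. f (of_real t + of_int m) * ?e k t) integrable_on ?I" for m :: int
          unfolding f_def by (intro integrable_continuous_interval continuous_intros)
        have e: "real (Suc N) - 1/2 = real N + 1/2" "- real (Suc N) + 1/2 = - real N - 1/2" by simp_all
        have "integral ?I (\<lambda>t. g (Suc N) (of_real t) * ?e k t) = 
            integral ?I (\<lambda>t. f (of_real t + of_int (int (Suc N))) * ?e k t + f (of_real t + of_int (- int (Suc N))) * ?e k t)"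
          by (intro integral_cong) (simp add: g_def algebra_simps)
        also have "\<dots> = integral {real (Suc N) - 1/2..real (Suc N) + 1/2} ?h + integral {- real (Suc N) - 1/2..- real (Suc N) + 1/2} ?h"
          unfolding integral_add[OF i i] shift by simp
        finally have g: "integral ?I (\<lambda>t. g (Suc N) (of_real t) * ?e k t) = K (real N + 1/2) (real (Suc N) + 1/2) + K (- real (Suc N) - 1/2) (- real N - 1/2)"
          unfolding K_def e .
        have c1: "K (- real (Suc N) - 1/2) (- real N - 1/2) + K (- real N - 1/2) (real N + 1/2) = K (- real (Suc N) - 1/2) (real N + 1/2)"
          by (rule comb) auto
        have c2: "K (- real (Suc N) - 1/2) (real N + 1/2) + K (real N + 1/2) (real (Suc N) + 1/2) = K (- real (Suc N) - 1/2) (real (Suc N) + 1/2)"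
          by (rule comb) auto
        have "K (- real (Suc N) - 1/2) (real (Suc N) + 1/2) = K (- real N - 1/2) (real N + 1/2) + integral ?I (\<lambda>t. g (Suc N) (of_real t) * ?e k t)"
          unfolding g c2[symmetric] c1[symmetric] by (simp only: add_ac)
        then show ?case
          using Suc unfolding K_def[symmetric] by (simp only: sum.lessThan_Suc)
      qed
      finally show ?thesis .
    qed
    have inth': "integrable lborel ?h" and valh: "(LINT t|lborel. ?h t) = of_real (exp (- pi * (of_int k)\<^sup>2 / x) / sqrt x)"
      using gaussian_fourier_transform[OF x, of "of_int k"] unfolding f_def by simp_all
    have "(\<lambda>N. LINT t|lborel. indicator {- real N - 1/2..real N + 1/2} t *\<^sub>R ?h t) \<longlonglongrightarrow> (LINT t|lborel. ?h t)"
    proof (rule integral_dominated_convergence[where w = "\<lambda>t. norm (?h t)"])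
      show "AE t in lborel. (\<lambda>N. indicator {- real N - 1/2..real N + 1/2} t *\<^sub>R ?h t) \<longlonglongrightarrow> ?h t"
      proof (rule AE_I2, rule tendsto_eventually)
        fix t :: real
        obtain N0 where "real N0 \<ge> \<bar>t\<bar>" using real_arch_simple by blast
        then show "\<forall>\<^sub>F N in sequentially. indicator {- real N - 1/2..real N + 1/2} t *\<^sub>R ?h t = ?h t"
          by (intro eventually_sequentiallyI[of N0]) (auto simp: indicator_def abs_if split: if_splits)
      qed
    qed (use inth' in \<open>auto simp: indicator_def\<close>)
    moreover have "(LINT t|lborel. indicator {a..b} t *\<^sub>R ?h t) = integral {a..b} ?h" for a b
      using set_borel_integral_eq_integral(2)[of "{a..b}" ?h] integrable_mult_indicator[OF _ inth', of "{a..b}"]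
      by (simp add: set_integrable_def set_lebesgue_integral_def)
    ultimately have "(\<lambda>N. I (Suc N)) \<longlonglongrightarrow> of_real (exp (- pi * (of_int k)\<^sup>2 / x) / sqrt x)"
      by (simp only: I valh)
    moreover have "(\<lambda>N. I (Suc N)) \<longlonglongrightarrow> J" using IJ(3) by (rule LIMSEQ_Suc)
    ultimately show ?thesis using LIMSEQ_unique cJ by blast
  qed
  have "(\<lambda>n. c (int (Suc n)) + c (- int (Suc n))) sums (F 0 - c 0)"
    using fourier_coeffs_sums_at_0[OF holF] unfolding c_def .
  moreover have "c (int (Suc n)) + c (- int (Suc n)) = complex_of_real (2 / sqrt x * exp (- pi * (Suc n)\<^sup>2 / x))" for n
  proof -
    have "c (- int (Suc n)) = c (int (Suc n))" by (simp only: c of_int_minus power2_minus)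
    then have "c (int (Suc n)) + c (- int (Suc n)) = 2 * c (int (Suc n))" by (simp only: mult_2)
    then show ?thesis by (simp add: c)
  qed
  ultimately have "(\<lambda>n. complex_of_real (2 / sqrt x * exp (- pi * (Suc n)\<^sup>2 / x))) sums (F 0 - c 0)"
    by (simp only:)
  moreover have F0: "F 0 = of_real (1 + 2 * (\<Sum>n. exp (- pi * (Suc n)\<^sup>2 * x)))"
  proof -
    have sg: "summable (\<lambda>n. g n 0)"
      using bound[of 0] by (intro summable_comparison_test[OF _ sumM]) auto
    have gs: "g (Suc n) 0 = of_real (2 * exp (- pi * (Suc n)\<^sup>2 * x))" for n
    proof -
      have "(- 1 - complex_of_nat n)\<^sup>2 = (1 + of_nat n)\<^sup>2" by (simp add: power2_eq_square algebra_simps)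
      then show ?thesis by (simp add: g_def f_def exp_of_real[symmetric] mult_ac)
    qed
    have "summable (\<lambda>n. g (Suc n) 0)" using sg by (subst summable_Suc_iff)
    then have "summable (\<lambda>n. 2 * exp (- pi * (Suc n)\<^sup>2 * x))"
      unfolding gs summable_complex_of_real .
    moreover from this have "summable (\<lambda>n. exp (- pi * (Suc n)\<^sup>2 * x))"
      using summable_cmult_iff[of "2::real"] by simp
    moreover have "F 0 = g 0 0 + (\<Sum>n. g (Suc n) 0)" 
      unfolding F_def using suminf_split_head[OF sg] by simp
    ultimately show ?thesis
      unfolding gs by (simp add: suminf_of_real[symmetric] suminf_mult g_def f_def)
  qed
  moreover have "c 0 = of_real (1 / sqrt x)" by (simp add: c)
  ultimately have "(\<lambda>n. complex_of_real (2 / sqrt x * exp (- pi * (Suc n)\<^sup>2 / x))) sums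
      of_real (1 + 2 * (\<Sum>n. exp (- pi * (Suc n)\<^sup>2 * x)) - 1 / sqrt x)"
    by simp
  then have s: "(\<lambda>n. 2 / sqrt x * exp (- pi * (Suc n)\<^sup>2 / x)) sums (1 + 2 * (\<Sum>n. exp (- pi * (Suc n)\<^sup>2 * x)) - 1 / sqrt x)"
    unfolding sums_of_real_iff .
  then have "summable (\<lambda>n. 2 / sqrt x * exp (- pi * (Suc n)\<^sup>2 / x))" by (rule sums_summable)
  then have "summable (\<lambda>n. exp (- pi * (Suc n)\<^sup>2 / x))"
    using x summable_cmult_iff[of "2 / sqrt x"] by simp
  from suminf_mult[OF this, of "2 / sqrt x"] sums_unique[OF s]
  have "2 / sqrt x * (\<Sum>n. exp (- pi * (Suc n)\<^sup>2 / x)) = 1 + 2 * (\<Sum>n. exp (- pi * (Suc n)\<^sup>2 * x)) - 1 / sqrt x"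
    by simp
  then show ?thesis using x by (simp add: field_simps)
qed

section \<open>Decay of the theta series\<close>

text \<open>
  In terms of \<open>\<theta> x = (\<Sum>n. exp (- pi * n\<^sup>2 * x))\<close>, summed over all integers, this is
  \<open>(\<theta> (exp (2 * u)) - 1) / 2\<close>. In the logarithmic variable \<open>u\<close> the inversion \<open>x \<mapsto> 1 / x\<close> of the
  transformation formula becomes the reflection \<open>u \<mapsto> - u\<close>, and Mellin transforms become integrals
  of \<open>exp (s * u)\<close> over the line.
\<close>
definition psi :: "real \<Rightarrow> real" where
  "psi u = (\<Sum>n. exp (- pi * (Suc n)\<^sup>2 * exp (2 * u)))"

lemma psi_term_le:
  assumes "y \<ge> 0"
  shows "exp (- pi * (Suc n)\<^sup>2 * y) \<le> exp (- pi * y) ^ Suc n"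
proof -
  have "real (Suc n) * 1 \<le> real (Suc n) * real (Suc n)" by (intro mult_left_mono) auto
  then have "real (Suc n) \<le> (real (Suc n))\<^sup>2" by (simp add: power2_eq_square)
  then have "real (Suc n) * (pi * y) \<le> (real (Suc n))\<^sup>2 * (pi * y)"
    using assms by (intro mult_right_mono) auto
  then show ?thesis
    unfolding exp_of_nat_mult[symmetric] by (simp only: exp_le_cancel_iff of_nat_power mult_ac minus_mult_left minus_mult_right) (simp add: mult_ac)
qed

lemma psi_summable: "summable (\<lambda>n. exp (- pi * (Suc n)\<^sup>2 * exp (2 * u)))"
proof (rule summable_comparison_test)
  show "\<exists>N. \<forall>n\<ge>N. norm (exp (- pi * (Suc n)\<^sup>2 * exp (2 * u))) \<le> exp (- pi * exp (2 * u)) ^ Suc n"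
    using psi_term_le[of "exp (2 * u)"] by simp
  show "summable (\<lambda>n. exp (- pi * exp (2 * u)) ^ Suc n)"
    unfolding summable_Suc_iff by (rule summable_geometric) simp
qed

lemma psi_pos: "psi u > 0"
  unfolding psi_def by (intro suminf_pos psi_summable) auto

lemma psi_reflect: "psi (- u) = exp u * psi u + (exp u - 1) / 2"
proof -
  have "sqrt (exp (2 * u)) = exp u"
    by (rule real_sqrt_unique) (auto simp: power2_eq_square simp flip: exp_add)
  moreover have "- pi * (Suc n)\<^sup>2 / exp (2 * u) = - pi * (Suc n)\<^sup>2 * exp (2 * (- u))" for n
    by (simp add: exp_minus field_simps)
  ultimately have "1 + 2 * psi u = (1 + 2 * psi (- u)) / exp u"
    using theta_transformation[of "exp (2 * u)"] unfolding psi_def by simp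
  then show ?thesis by (simp add: field_simps)
qed

lemma exp_minus_pi_le: "exp (- pi) \<le> 1 / 8"
proof -
  have "exp (1::real) \<ge> 2" using exp_ge_add_one_self[of 1] by simp
  then have "exp (1::real) ^ 3 \<ge> 2 ^ 3" by (intro power_mono) auto
  then have "exp (3::real) \<ge> 8" by (simp flip: exp_of_nat_mult)
  moreover have "exp (3::real) \<le> exp pi" using pi_gt3 by simp
  ultimately have "exp pi \<ge> 8" by linarith
  then show ?thesis by (simp add: exp_minus field_simps)
qed

lemma psi_le:
  assumes "u \<ge> 0"
  shows "psi u \<le> 2 * exp (- pi * exp (2 * u))"
proof -
  define q where "q = exp (- pi * exp (2 * u))"
  have "pi * exp (2 * u) \<ge> pi * 1" using assms by (intro mult_left_mono) auto
  then have "q \<le> exp (- pi)" by (simp add: q_def)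
  then have q: "0 < q" "q \<le> 1 / 8" using exp_minus_pi_le unfolding q_def by (simp, linarith)
  have "psi u \<le> (\<Sum>n. q ^ Suc n)"
    unfolding psi_def
  proof (rule suminf_le)
    show "exp (- pi * (Suc n)\<^sup>2 * exp (2 * u)) \<le> q ^ Suc n" for n
      using psi_term_le[of "exp (2 * u)"] by (simp add: q_def)
    show "summable (\<lambda>n. q ^ Suc n)"
      unfolding summable_Suc_iff using q by (intro summable_geometric) auto
  qed (rule psi_summable)
  also have "\<dots> = q * (1 / (1 - q))"
    using q suminf_mult[of "\<lambda>n. q ^ n" q] suminf_geometric[of q] by (simp add: summable_geometric)
  also have "\<dots> \<le> q * 2" using q by (intro mult_left_mono) (auto simp: field_simps)
  finally show ?thesis by (simp add: q_def)
qed

lemma exp_minus_le_fact_div_power: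
  assumes "y > (0::real)"
  shows "exp (- y) \<le> fact k / y ^ k"
proof -
  have "(\<Sum>n\<in>{k}. y ^ n /\<^sub>R fact n) \<le> (\<Sum>n. y ^ n /\<^sub>R fact n)"
    using assms by (intro sum_le_suminf summable_exp_generic) auto
  then have "y ^ k / fact k \<le> exp y" by (simp add: exp_def divide_inverse mult_ac)
  then show ?thesis using assms by (simp add: exp_minus field_simps)
qed

text \<open>
  Only part of the double exponential decay is kept: the free parameter \<open>k\<close> is later matched
  to \<open>norm s\<close>, and the factorial is what ends up as the growth rate of \<open>theta_xi\<close>.
\<close>
lemma psi_le_fact:
  assumes "u \<ge> 0"
  shows "psi u \<le> 2 * fact k * exp (- 2 * real k * u)"
proof -
  have "exp (- (pi * exp (2 * u))) \<le> exp (- exp (2 * u))"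
    using pi_gt3 by simp
  also have "\<dots> \<le> fact k / exp (2 * u) ^ k" by (rule exp_minus_le_fact_div_power) simp
  also have "\<dots> = fact k * exp (- 2 * real k * u)"
    by (simp add: exp_minus field_simps flip: exp_of_nat_mult)
  finally show ?thesis using psi_le[OF assms] by simp
qed

lemma continuous_on_psi: "continuous_on {0..} psi"
proof (rule uniform_limit_theorem)
  show "uniform_limit {0..} (\<lambda>N u. \<Sum>n<N. exp (- pi * (Suc n)\<^sup>2 * exp (2 * u))) psi sequentially"
    unfolding psi_def
  proof (rule Weierstrass_m_test)
    show "summable (\<lambda>n. exp (- pi) ^ Suc n)"
      unfolding summable_Suc_iff by (rule summable_geometric) simp
    fix n and u :: real assume "u \<in> {0..}"
    then have "pi * exp (2 * u) \<ge> pi * 1" by (intro mult_left_mono) auto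
    then have "exp (- pi * exp (2 * u)) ^ Suc n \<le> exp (- pi) ^ Suc n" by (intro power_mono) auto
    then show "norm (exp (- pi * (Suc n)\<^sup>2 * exp (2 * u))) \<le> exp (- pi) ^ Suc n"
      using psi_term_le[of "exp (2 * u)" n] by simp
  qed
  show "\<forall>\<^sub>F N in sequentially. continuous_on {0..} (\<lambda>u. \<Sum>n<N. exp (- pi * (Suc n)\<^sup>2 * exp (2 * u)))"
    by (intro always_eventually allI continuous_intros)
qed auto

section \<open>The xi-function as an integral over the theta series\<close>

definition xi_kernel :: "complex \<Rightarrow> real \<Rightarrow> complex" where
  "xi_kernel s u = (exp (s * of_real u) + exp ((1 - s) * of_real u)) * of_real (psi u)"

text \<open>
  Riemann's representation of the xi-function: the Mellin integral of the theta series, folded at the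
  fixed point \<open>u = 0\<close> of the transformation formula. The symmetry \<open>s \<mapsto> 1 - s\<close> is visible in the
  kernel, and the integral converges for every \<open>s\<close>.
\<close>
definition theta_xi :: "complex \<Rightarrow> complex" where
  "theta_xi s = 1 / 2 + s * (s - 1) * integral {0..} (xi_kernel s)"

text \<open>
  The hypothesis on \<open>k\<close> makes the decay \<open>exp (- 2 * k * u)\<close> of \<open>psi\<close> beat the growth
  \<open>exp ((1 + norm s) * u)\<close> of the exponentials with a factor \<open>exp (- u)\<close> to spare.
\<close>
lemma xi_kernel_norm_le:
  assumes "u \<ge> 0" "norm s + 2 \<le> 2 * real k"
  shows "norm (xi_kernel s u) \<le> 4 * fact k * exp (- u)"
proof -
  have "norm (exp (s * of_real u)) \<le> exp ((1 + norm s) * u)"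
    using assms complex_Re_le_cmod[of s] by (auto intro!: mult_right_mono)
  moreover have "norm (exp ((1 - s) * of_real u)) \<le> exp ((1 + norm s) * u)"
    using assms abs_Re_le_cmod[of s] by (auto intro!: mult_right_mono)
  ultimately have "norm (exp (s * of_real u) + exp ((1 - s) * of_real u)) \<le> 2 * exp ((1 + norm s) * u)"
    using norm_triangle_ineq[of "exp (s * of_real u)" "exp ((1 - s) * of_real u)"] by linarith
  then have "norm (xi_kernel s u) \<le> 2 * exp ((1 + norm s) * u) * (2 * fact k * exp (- 2 * real k * u))"
    unfolding xi_kernel_def norm_mult
    using psi_le_fact[OF assms(1), of k] psi_pos[of u] by (intro mult_mono) auto
  also have "\<dots> = 4 * fact k * exp ((1 + norm s) * u - 2 * real k * u)"
    by (simp add: exp_diff exp_minus divide_inverse mult_ac)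
  also have "\<dots> \<le> 4 * fact k * exp (- u)"
  proof -
    have "(norm s + 2) * u \<le> 2 * real k * u" using assms by (intro mult_right_mono) auto
    then show ?thesis by (simp add: algebra_simps)
  qed
  finally show ?thesis .
qed

lemma continuous_on_xi_kernel: "continuous_on {0..} (xi_kernel s)"
  unfolding xi_kernel_def[abs_def] by (intro continuous_intros continuous_on_psi)

lemma xi_kernel_absolutely_integrable:
  assumes "c \<ge> 0"
  shows "xi_kernel s absolutely_integrable_on {c..}"
proof -
  obtain k :: nat where k: "norm s + 2 \<le> real k" using real_arch_simple by blast
  show ?thesis
  proof (rule measurable_bounded_by_integrable_imp_absolutely_integrable)
    show "xi_kernel s \<in> borel_measurable (lebesgue_on {c..})"
      using assms by (intro continuous_imp_measurable_on_sets_lebesgue continuous_on_subset[OF continuous_on_xi_kernel]) auto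
    show "(\<lambda>u. 4 * fact k * exp (- u)) integrable_on {c..}"
      using integrable_on_exp_minus_to_infinity[of 1 c] by simp
    show "norm (xi_kernel s u) \<le> 4 * fact k * exp (- u)" if "u \<in> {c..}" for u
      using that assms k by (intro xi_kernel_norm_le) auto
  qed auto
qed

lemma xi_kernel_tail_norm_le:
  assumes "c \<ge> 0" "norm s + 2 \<le> 2 * real k"
  shows "norm (integral {c..} (xi_kernel s)) \<le> 4 * fact k * exp (- c)"
proof -
  have h: "((\<lambda>u. 4 * fact k * exp (- u)) has_integral 4 * fact k * exp (- c)) {c..}"
    using has_integral_mult_right[OF has_integral_exp_minus_to_infinity[of 1 c], of "4 * fact k"] by simp
  have "norm (integral {c..} (xi_kernel s)) \<le> integral {c..} (\<lambda>u. 4 * fact k * exp (- u))"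
  proof (rule Henstock_Kurzweil_Integration.integral_norm_bound_integral)
    show "xi_kernel s integrable_on {c..}"
      using xi_kernel_absolutely_integrable[OF assms(1)] by (rule set_lebesgue_integral_eq_integral(1))
    show "(\<lambda>u. 4 * fact k * exp (- u)) integrable_on {c..}" using h by blast
    show "norm (xi_kernel s u) \<le> 4 * fact k * exp (- u)" if "u \<in> {c..}" for u
      using that assms by (intro xi_kernel_norm_le) auto
  qed
  also have "\<dots> = 4 * fact k * exp (- c)" using h by (rule integral_unique)
  finally show ?thesis .
qed

text \<open>
  The integrals over \<open>[0, N]\<close> are holomorphic by differentiation under the integral sign, and the
  bound on the tail is uniform for \<open>s\<close> in a disc.
\<close>
lemma holomorphic_theta_xi: "theta_xi holomorphic_on UNIV"
proof -
  have "(\<lambda>s. integral {0..} (xi_kernel s)) holomorphic_on UNIV"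
  proof (rule holomorphic_uniform_sequence)
    fix N :: nat
    have "(\<lambda>s. integral (cbox 0 (real N)) (xi_kernel s)) holomorphic_on UNIV"
    proof (rule leibniz_rule_holomorphic)
      fix s :: complex and t :: real
      show "((\<lambda>s. xi_kernel s t) has_field_derivative
          (of_real t * exp (s * of_real t) - of_real t * exp ((1 - s) * of_real t)) * of_real (psi t)) (at s within UNIV)"
        unfolding xi_kernel_def by (auto intro!: derivative_eq_intros simp: algebra_simps)
      show "xi_kernel s integrable_on cbox 0 (real N)"
        by (intro integrable_continuous continuous_on_subset[OF continuous_on_xi_kernel]) auto
      have "continuous_on (UNIV \<times> cbox 0 (real N)) (\<lambda>x :: complex \<times> real. psi (snd x))"
        by (rule continuous_on_compose2[OF continuous_on_psi]) (auto intro!: continuous_intros)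
      then show "continuous_on (UNIV \<times> cbox 0 (real N)) (\<lambda>(s :: complex, t). 
          (of_real t * exp (s * of_real t) - of_real t * exp ((1 - s) * of_real t)) * of_real (psi t))"
        unfolding case_prod_unfold by (intro continuous_intros) auto
    qed auto
    then show "(\<lambda>s. integral {0..real N} (xi_kernel s)) holomorphic_on UNIV" by simp
  next
    fix z :: complex
    obtain k :: nat where k: "norm z + 3 \<le> real k" using real_arch_simple by blast
    have "uniform_limit (cball z 1) (\<lambda>N s. integral {0..real N} (xi_kernel s)) (\<lambda>s. integral {0..} (xi_kernel s)) sequentially"
    proof (rule uniform_limitI)
      fix e :: real assume "e > 0"
      have "(\<lambda>N. 4 * fact k * exp (- 1) ^ N) \<longlonglongrightarrow> 4 * fact k * (0::real)"
        by (intro tendsto_intros LIMSEQ_power_zero) auto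
      then have "\<forall>\<^sub>F N in sequentially. 4 * fact k * exp (- 1) ^ N < e"
        using \<open>e > 0\<close> by (intro order_tendstoD(2)) auto
      then show "\<forall>\<^sub>F N in sequentially. \<forall>s\<in>cball z 1. dist (integral {0..real N} (xi_kernel s)) (integral {0..} (xi_kernel s)) < e"
      proof eventually_elim
        fix N assume N: "4 * fact k * exp (- 1) ^ N < e"
        show "\<forall>s\<in>cball z 1. dist (integral {0..real N} (xi_kernel s)) (integral {0..} (xi_kernel s)) < e"
        proof
          fix s assume "s \<in> cball z 1"
          then have "norm s \<le> norm z + 1"
            using norm_triangle_ineq2[of s z] by (auto simp: dist_norm norm_minus_commute)
          then have s: "norm s + 2 \<le> 2 * real k" using k norm_ge_zero[of z] by linarith
          have i: "xi_kernel s integrable_on {c..}" if "c \<ge> 0" for c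
            using xi_kernel_absolutely_integrable[OF that] by (rule set_lebesgue_integral_eq_integral(1))
          have "(xi_kernel s has_integral (integral {0..real N} (xi_kernel s) + integral {real N..} (xi_kernel s))) ({0..real N} \<union> {real N..})"
          proof (rule has_integral_Un)
            show "(xi_kernel s has_integral integral {0..real N} (xi_kernel s)) {0..real N}"
              by (intro integrable_integral integrable_continuous_interval continuous_on_subset[OF continuous_on_xi_kernel]) auto
            show "(xi_kernel s has_integral integral {real N..} (xi_kernel s)) {real N..}"
              by (intro integrable_integral i) auto
            have "{0..real N} \<inter> {real N..} = {real N}" by auto
            then show "negligible ({0..real N} \<inter> {real N..})" by simp
          qed
          moreover have "{0..real N} \<union> {real N..} = {0..}" by auto
          ultimately have "integral {0..} (xi_kernel s) = integral {0..real N} (xi_kernel s) + integral {real N..} (xi_kernel s)"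
            by (simp add: integral_unique)
          then have "dist (integral {0..real N} (xi_kernel s)) (integral {0..} (xi_kernel s)) = norm (integral {real N..} (xi_kernel s))"
            by (simp add: dist_norm)
          also have "\<dots> \<le> 4 * fact k * exp (- real N)"
            using s by (intro xi_kernel_tail_norm_le) auto
          also have "exp (- real N) = exp (- 1) ^ N" by (simp flip: exp_of_nat_mult)
          finally show "dist (integral {0..real N} (xi_kernel s)) (integral {0..} (xi_kernel s)) < e"
            using N by simp
        qed
      qed
    qed
    then show "\<exists>d>0. cball z d \<subseteq> UNIV \<and> uniform_limit (cball z d) (\<lambda>N s. integral {0..real N} (xi_kernel s)) (\<lambda>s. integral {0..} (xi_kernel s)) sequentially"
      by (intro exI[of _ 1]) auto
  qed auto
  then show ?thesis
    unfolding theta_xi_def[abs_def] by (intro holomorphic_intros)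
qed

lemma theta_xi_reflect: "theta_xi (1 - s) = theta_xi s"
proof -
  have "xi_kernel (1 - s) = xi_kernel s" by (auto simp: xi_kernel_def add.commute)
  then show ?thesis by (simp add: theta_xi_def algebra_simps)
qed

lemma theta_xi_cnj: "theta_xi (cnj s) = cnj (theta_xi s)"
proof -
  have "(\<lambda>u. cnj (xi_kernel s u)) = xi_kernel (cnj s)"
    by (auto simp: xi_kernel_def exp_cnj)
  then show ?thesis by (simp add: theta_xi_def integral_cnj)
qed

lemma theta_xi_norm_le:
  assumes "norm s + 2 \<le> 2 * real k"
  shows "norm (theta_xi s) \<le> 1 / 2 + norm s * (norm s + 1) * (4 * fact k)"
proof -
  have "norm (theta_xi s) \<le> 1 / 2 + norm (s * (s - 1) * integral {0..} (xi_kernel s))"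
    unfolding theta_xi_def by (rule order_trans[OF norm_triangle_ineq]) simp
  also have "norm (s * (s - 1) * integral {0..} (xi_kernel s)) \<le> norm s * (norm s + 1) * (4 * fact k)"
    unfolding norm_mult
    using xi_kernel_tail_norm_le[of 0, OF _ assms] norm_triangle_ineq4[of s 1]
    by (intro mult_mono) auto
  finally show ?thesis by simp
qed

text \<open>
  The kernel is positive for real \<open>s = x\<close>. Outside \<open>[0, 1]\<close> the factor \<open>x * (x - 1)\<close> is nonnegative;
  inside it is at least \<open>- 1 / 4\<close> while the integral is at most \<open>1 / 2\<close>, so it cannot cancel the constant
  \<open>1 / 2\<close>. Since \<open>1 - a\<close> is real, this implies that the denominators \<open>\<rho> + a - 1\<close> do not vanish.
\<close>
lemma theta_xi_real_nonzero: "theta_xi (of_real x) \<noteq> 0"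
proof -
  define J where "J = integral {0..} (xi_kernel (of_real x))"
  have i: "xi_kernel (of_real x) integrable_on {0..}"
    using xi_kernel_absolutely_integrable[of 0] by (intro set_lebesgue_integral_eq_integral(1)) auto
  have R: "Re (xi_kernel (of_real x) u) = (exp (x * u) + exp ((1 - x) * u)) * psi u" for u
  proof -
    have "xi_kernel (of_real x) u = of_real ((exp (x * u) + exp ((1 - x) * u)) * psi u)"
      by (simp add: xi_kernel_def exp_of_real[symmetric])
    then show ?thesis by (simp only: Re_complex_of_real)
  qed
  have ReJ: "((\<lambda>u. (exp (x * u) + exp ((1 - x) * u)) * psi u) has_integral Re J) {0..}"
    using has_integral_linear[OF integrable_integral[OF i] bounded_linear_Re] by (simp add: o_def R J_def)
  have Re: "Re (theta_xi (of_real x)) = 1 / 2 + x * (x - 1) * Re J"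
    by (simp add: theta_xi_def J_def[symmetric] algebra_simps)
  have J0: "Re J \<ge> 0"
    by (rule has_integral_nonneg[OF ReJ]) (use psi_pos in \<open>auto simp: less_imp_le\<close>)
  have "Re (theta_xi (of_real x)) > 0"
  proof (cases "0 \<le> x \<and> x \<le> 1")
    case False
    then have "x * (x - 1) \<ge> 0" by (auto simp: zero_le_mult_iff)
    from mult_nonneg_nonneg[OF this J0] show ?thesis unfolding Re by linarith
  next
    case True
    have "((\<lambda>u::real. 1 / 2 * exp (- 1 * u)) has_integral 1 / 2 * (exp (- 1 * 0) / 1 :: real)) {0..}"
      by (rule has_integral_mult_right, rule has_integral_exp_minus_to_infinity) simp
    with ReJ have "Re J \<le> 1 / 2 * (exp (- 1 * 0) / 1)"
    proof (rule has_integral_le)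
      fix u :: real assume u: "u \<in> {0..}"
      have "exp (x * u) \<le> exp u" "exp ((1 - x) * u) \<le> exp u"
        using True u by (auto intro: mult_left_le_one_le)
      moreover have "psi u \<le> 2 * exp (- pi) * exp (- 2 * u)"
      proof -
        have "2 * u \<le> 2 * u * pi" using mult_left_mono[of 1 pi "2 * u"] pi_gt3 u by simp
        moreover have "pi * (1 + 2 * u) \<le> pi * exp (2 * u)"
          using exp_ge_add_one_self[of "2 * u"] by (intro mult_left_mono) auto
        ultimately have "- pi * exp (2 * u) \<le> - pi + - 2 * u" by (simp add: algebra_simps)
        then have "exp (- pi * exp (2 * u)) \<le> exp (- pi) * exp (- 2 * u)"
          unfolding exp_add[symmetric] by simp
        then show ?thesis using psi_le[of u] u by simp
      qed
      ultimately have "(exp (x * u) + exp ((1 - x) * u)) * psi u \<le> (exp u + exp u) * (2 * exp (- pi) * exp (- 2 * u))"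
        using psi_pos[of u] by (intro mult_mono add_mono) auto
      also have "\<dots> = 4 * exp (- pi) * exp (- u)"
        by (simp add: algebra_simps flip: exp_add)
      also have "\<dots> \<le> 1 / 2 * exp (- 1 * u)"
        using exp_minus_pi_le by (simp add: mult_right_mono)
      finally show "(exp (x * u) + exp ((1 - x) * u)) * psi u \<le> 1 / 2 * exp (- 1 * u)" .
    qed
    then have "Re J \<le> 1 / 2" by simp
    moreover have "x * (1 - x) \<le> 1 / 4" 
    proof -
      have "(x - 1 / 2)\<^sup>2 \<ge> 0" by simp
      then show ?thesis by (simp add: power2_eq_square algebra_simps)
    qed
    ultimately have "(x * (1 - x)) * Re J \<le> 1 / 4 * (1 / 2)"
      using True J0 by (intro mult_mono) auto
    then show ?thesis unfolding Re by (simp add: algebra_simps)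
  qed
  then show ?thesis by auto
qed

section \<open>The Mellin transform of the theta series\<close>

text \<open>
  Euler's integral after the substitution \<open>t = exp v\<close>.
\<close>
lemma Gamma_log_integral:
  assumes "Re z > 0"
  shows "integrable lborel (\<lambda>v. exp (z * of_real v) * of_real (exp (- exp v)))"
    and "(LINT v|lborel. exp (z * of_real v) * of_real (exp (- exp v))) = Gamma z"
proof -
  let ?f = "\<lambda>t. complex_of_real t powr (z - 1) / of_real (exp t)"
  let ?h = "\<lambda>v. exp (z * of_real v) * complex_of_real (exp (- exp v))"
  have im: "range (exp :: real \<Rightarrow> real) = {0<..}"
    by (auto simp: image_iff) (metis exp_ln)
  have "?f absolutely_integrable_on exp ` UNIV \<and> integral (exp ` UNIV) ?f = Gamma z"
    unfolding im using absolutely_integrable_Gamma_integral'[OF assms] Gamma_integral_complex'[OF assms]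
    by (auto intro: integral_unique)
  then have "(\<lambda>v. \<bar>exp v\<bar> *\<^sub>R ?f (exp v)) absolutely_integrable_on UNIV \<and> integral UNIV (\<lambda>v. \<bar>exp v\<bar> *\<^sub>R ?f (exp v)) = Gamma z"
    by (subst has_absolute_integral_change_of_variables_real) (auto intro!: derivative_eq_intros inj_onI)
  moreover have "\<bar>exp v\<bar> *\<^sub>R ?f (exp v) = ?h v" for v
  proof -
    have "complex_of_real (exp v) powr (z - 1) = exp ((z - 1) * of_real v)"
      by (simp add: powr_def Ln_of_real)
    then show ?thesis
      by (simp add: scaleR_conv_of_real exp_minus field_simps exp_of_real[symmetric]) (simp add: algebra_simps flip: exp_add)
  qed
  ultimately have ai: "?h absolutely_integrable_on UNIV" and v: "integral UNIV ?h = Gamma z" by simp_all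
  have "?h \<in> borel_measurable borel"
    by (intro borel_measurable_continuous_onI continuous_intros)
  then have m: "?h \<in> borel_measurable lborel" by simp
  show i: "integrable lborel ?h"
    using ai integrable_completion[OF m] by (simp add: set_integrable_def)
  then show "(LINT v|lborel. ?h v) = Gamma z"
    using v integral_lborel[OF i] by simp
qed

text \<open>
  The substitution \<open>v = 2 * u + ln (pi * N\<^sup>2)\<close> extracts the \<open>N\<close>-th term of the Dirichlet series.
\<close>
lemma Gamma_scaled_log_integral:
  fixes N :: nat
  assumes s: "Re s > 0" and N: "N > 0"
  shows "integrable lborel (\<lambda>u. exp (s * of_real u) * of_real (exp (- pi * N\<^sup>2 * exp (2 * u))))"
    and "(LINT u|lborel. exp (s * of_real u) * of_real (exp (- pi * N\<^sup>2 * exp (2 * u))))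
        = of_real pi powr (- s / 2) * Gamma (s / 2) / 2 * (1 / of_nat N powr s)"
proof -
  let ?h = "\<lambda>v. exp (s / 2 * of_real v) * complex_of_real (exp (- exp v))"
  let ?g = "\<lambda>u. exp (s * of_real u) * complex_of_real (exp (- pi * N\<^sup>2 * exp (2 * u)))"
  define c where "c = ln (pi * N\<^sup>2)"
  define w where "w = of_real pi powr (s / 2) * of_nat N powr s"
  have w0: "w \<noteq> 0" using N by (simp add: w_def)
  have ec: "exp c = pi * N\<^sup>2" using N by (simp add: c_def)
  have "c = ln pi + 2 * ln N" using N by (simp add: c_def ln_mult ln_realpow)
  then have sc: "exp (s / 2 * of_real c) = w"
    using N by (simp add: w_def powr_def Ln_of_real Ln_of_nat algebra_simps flip: exp_add)
  have h: "?h (c + 2 * u) = w * ?g u" for u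
  proof -
    have "exp (c + 2 * u) = pi * N\<^sup>2 * exp (2 * u)" by (simp add: exp_add ec)
    moreover have "exp (s / 2 * of_real (c + 2 * u)) = w * exp (s * of_real u)"
      by (simp add: ring_distribs exp_add flip: sc)
    ultimately show ?thesis by (simp only: mult.assoc minus_mult_left)
  qed
  have s2: "Re (s / 2) > 0" using s by simp
  have "integrable lborel (\<lambda>u. ?h (c + 2 * u))"
    using Gamma_log_integral(1)[OF s2] by (subst lborel_integrable_real_affine_iff) auto
  then have "integrable lborel (\<lambda>u. w * ?g u)" unfolding h .
  then have "integrable lborel (\<lambda>u. inverse w * (w * ?g u))" by (rule integrable_mult_right)
  moreover have "inverse w * (w * x) = x" for x using w0 by simp
  ultimately show "integrable lborel ?g" by (simp only:)
  have "Gamma (s / 2) = \<bar>2\<bar> *\<^sub>R (LINT u|lborel. ?h (c + 2 * u))"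
    using lborel_integral_real_affine[of 2 ?h c] Gamma_log_integral(2)[OF s2] by simp
  also have "\<dots> = 2 * w * (LINT u|lborel. ?g u)"
    unfolding h by (simp add: scaleR_conv_of_real)
  finally have "(LINT u|lborel. ?g u) = Gamma (s / 2) / (2 * w)"
    using w0 by (simp add: field_simps)
  also have "\<dots> = of_real pi powr (- s / 2) * Gamma (s / 2) / 2 * (1 / of_nat N powr s)"
    by (simp add: w_def powr_minus field_simps)
  finally show "(LINT u|lborel. ?g u) = of_real pi powr (- s / 2) * Gamma (s / 2) / 2 * (1 / of_nat N powr s)" .
qed

lemma norm_nat_powr: "norm (complex_of_nat (Suc n) powr s) = real (Suc n) powr Re s"
  using norm_powr_real_powr[of "complex_of_nat (Suc n)" s] by simp

lemma summable_nat_powr_norm: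
  assumes "Re s > 1"
  shows "summable (\<lambda>n. norm (1 / of_nat (Suc n) powr s))"
proof -
  have "summable (\<lambda>n. real n powr (- Re s))"
    using assms by (subst summable_real_powr_iff) auto
  then have "summable (\<lambda>n. real (Suc n) powr (- Re s))" by (subst summable_Suc_iff)
  moreover have "norm (1 / of_nat (Suc n) powr s) = real (Suc n) powr (- Re s)" for n
    unfolding norm_divide norm_nat_powr by (simp add: powr_minus divide_inverse)
  ultimately show ?thesis by simp
qed

text \<open>
  Termwise integration, justified by the absolute convergence of the Dirichlet series: the norms of the
  terms integrate to the same formula at the real point \<open>Re s\<close>.
\<close>
lemma psi_mellin:
  assumes s: "Re s > 1"
  shows "integrable lborel (\<lambda>u. exp (s * of_real u) * of_real (psi u))"
    and "(LINT u|lborel. exp (s * of_real u) * of_real (psi u)) =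
       of_real pi powr (- s / 2) * Gamma (s / 2) / 2 * (\<Sum>n. 1 / of_nat (Suc n) powr s)"
proof -
  let ?g = "\<lambda>n u. exp (s * of_real u) * complex_of_real (exp (- pi * (Suc n)\<^sup>2 * exp (2 * u)))"
  have s0: "Re s > 0" using s by simp
  have int: "integrable lborel (?g n)" for n
    by (rule Gamma_scaled_log_integral(1)[OF s0]) simp
  have sm: "summable (\<lambda>n. norm (?g n u))" for u
    unfolding norm_mult using psi_summable[of u] by (intro summable_mult) simp
  have nrm: "(LINT u|lborel. norm (?g n u)) = Re (of_real pi powr (- of_real (Re s) / 2) * Gamma (of_real (Re s) / 2) / 2) * norm (1 / of_nat (Suc n) powr s)" for n
  proof -
    let ?A = "of_real pi powr (- of_real (Re s) / 2) * Gamma (of_real (Re s) / 2) / (2 :: complex)"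
    have "complex_of_real (norm (?g n u)) = exp (of_real (Re s) * of_real u) * complex_of_real (exp (- pi * (Suc n)\<^sup>2 * exp (2 * u)))" for u
      by (simp add: norm_mult exp_of_real[symmetric])
    then have "complex_of_real (LINT u|lborel. norm (?g n u)) = ?A * (1 / of_nat (Suc n) powr (of_real (Re s)))"
      using Gamma_scaled_log_integral(2)[of "of_real (Re s)" "Suc n"] s0 by (simp add: integral_complex_of_real[symmetric])
    also have "1 / complex_of_nat (Suc n) powr (of_real (Re s)) = of_real (norm (1 / of_nat (Suc n) powr s))"
    proof -
      have "complex_of_nat (Suc n) powr (of_real (Re s)) = of_real (real (Suc n) powr Re s)"
        using powr_of_real[of "real (Suc n)" "Re s"] by simp
      moreover have "norm (complex_of_nat (Suc n) powr s) = real (Suc n) powr Re s"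
        by (rule norm_nat_powr)
      ultimately show ?thesis by (simp add: norm_divide)
    qed
    finally have "Re (complex_of_real (LINT u|lborel. norm (?g n u))) = Re (?A * of_real (norm (1 / of_nat (Suc n) powr s)))" by (simp only:)
    moreover have "Re (w * of_real r) = Re w * r" for w r by simp
    ultimately show ?thesis by (simp only: Re_complex_of_real)
  qed
  have sn: "summable (\<lambda>n. LINT u|lborel. norm (?g n u))"
    unfolding nrm by (intro summable_mult summable_nat_powr_norm s)
  have psi: "(\<Sum>n. ?g n u) = exp (s * of_real u) * of_real (psi u)" for u
    unfolding psi_def using psi_summable[of u]
    by (subst suminf_mult) (auto simp: suminf_of_real summable_of_real)
  show "integrable lborel (\<lambda>u. exp (s * of_real u) * of_real (psi u))"
    using integrable_suminf[OF int _ sn] sm unfolding psi by simp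
  have "(LINT u|lborel. exp (s * of_real u) * of_real (psi u)) = (\<Sum>n. LINT u|lborel. ?g n u)"
    using integral_suminf[OF int _ sn] sm unfolding psi by simp
  also have "\<dots> = (\<Sum>n. of_real pi powr (- s / 2) * Gamma (s / 2) / 2 * (1 / of_nat (Suc n) powr s))"
    using s0 by (intro suminf_cong Gamma_scaled_log_integral(2)) auto
  also have "\<dots> = of_real pi powr (- s / 2) * Gamma (s / 2) / 2 * (\<Sum>n. 1 / of_nat (Suc n) powr s)"
    using summable_norm_cancel[OF summable_nat_powr_norm[OF s]] by (rule suminf_mult)
  finally show "(LINT u|lborel. exp (s * of_real u) * of_real (psi u)) =
       of_real pi powr (- s / 2) * Gamma (s / 2) / 2 * (\<Sum>n. 1 / of_nat (Suc n) powr s)" .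
qed

lemma has_integral_exp_complex_to_infinity:
  assumes "Re c > 0"
  shows "((\<lambda>u. exp (- c * of_real u)) has_integral 1 / c) {0..}"
proof -
  have c: "c \<noteq> 0" using assms by auto
  have m: "(\<lambda>u. exp (- c * of_real u)) absolutely_integrable_on {0..}"
  proof (rule measurable_bounded_by_integrable_imp_absolutely_integrable)
    show "(\<lambda>u. exp (- c * of_real u)) \<in> borel_measurable (lebesgue_on {0..})"
      by (intro continuous_imp_measurable_on_sets_lebesgue continuous_intros) auto
    show "(\<lambda>u. exp (- Re c * u)) integrable_on {0..}"
      using integrable_on_exp_minus_to_infinity[OF assms, of 0] by simp
  qed auto
  then have i: "(\<lambda>u. exp (- c * of_real u)) integrable_on {0..}" by (rule set_lebesgue_integral_eq_integral(1))
  have D: "((\<lambda>u. exp (- c * of_real u)) has_integral (1 / c - exp (- c * of_real N) / c)) {0..N}" if "N \<ge> 0" for N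
  proof -
    have "((\<lambda>u. exp (- c * of_real u)) has_integral (- exp (- c * of_real N) / c - (- exp (- c * of_real 0) / c))) {0..N}"
    proof (rule fundamental_theorem_of_calculus)
      fix t
      have "((\<lambda>z. - exp (- c * z) / c) has_field_derivative exp (- c * of_real t)) (at (of_real t))"
        using c by (auto intro!: derivative_eq_intros)
      then show "((\<lambda>u. - exp (- c * of_real u) / c) has_vector_derivative exp (- c * of_real t)) (at t within {0..N})"
        by (rule has_vector_derivative_real_field)
    qed (use that in auto)
    then show ?thesis by simp
  qed
  let ?f = "\<lambda>u. exp (- c * of_real u)"
  have lim: "((\<lambda>N. 1 / c - exp (- c * of_real N) / c) \<longlongrightarrow> 1 / c - 0 / c) at_top"
  proof (intro tendsto_intros c)
    have "((\<lambda>N::real. exp (- (Re c * N))) \<longlongrightarrow> 0) at_top"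
      by (intro filterlim_compose[OF exp_at_bot] filterlim_compose[OF filterlim_uminus_at_bot_at_top] filterlim_tendsto_pos_mult_at_top[OF tendsto_const assms] filterlim_ident)
    then have "((\<lambda>N. norm (exp (- c * of_real N))) \<longlongrightarrow> 0) at_top" by simp
    then show "((\<lambda>N. exp (- c * of_real N)) \<longlongrightarrow> 0) at_top" by (rule tendsto_norm_zero_cancel)
  qed
  have t: "((\<lambda>N. set_lebesgue_integral lebesgue {0..N} ?f) \<longlongrightarrow> set_lebesgue_integral lebesgue {0..} ?f) at_top"
    by (rule tendsto_set_lebesgue_integral_at_top) (use m in auto)
  have ev: "\<forall>\<^sub>F N in at_top. set_lebesgue_integral lebesgue {0..N} ?f = 1 / c - exp (- c * of_real N) / c"
    using eventually_ge_at_top[of 0]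
  proof eventually_elim
    fix N :: real assume "N \<ge> 0"
    have "?f absolutely_integrable_on {0..N}" by (rule set_integrable_subset[OF m]) auto
    then have "set_lebesgue_integral lebesgue {0..N} ?f = integral {0..N} ?f"
      by (rule set_lebesgue_integral_eq_integral(2))
    then show "set_lebesgue_integral lebesgue {0..N} ?f = 1 / c - exp (- c * of_real N) / c"
      using integral_unique[OF D[OF \<open>N \<ge> 0\<close>]] by simp
  qed
  have "((\<lambda>N. set_lebesgue_integral lebesgue {0..N} ?f) \<longlongrightarrow> 1 / c - 0 / c) at_top"
    using lim tendsto_cong[OF ev] by blast
  then have "set_lebesgue_integral lebesgue {0..} ?f = 1 / c"
    using tendsto_unique[OF trivial_limit_at_top_linorder t] by simp
  then show ?thesis
    using set_lebesgue_integral_eq_integral(2)[OF m] integrable_integral[OF i] by simp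
qed

text \<open>
  The integral over the negative half-line is reflected to the positive one with \<open>psi_reflect\<close>. This
  completes the kernel of \<open>theta_xi\<close> up to an elementary term, whose integral
  \<open>(1 / (s - 1) - 1 / s) / 2 = 1 / (2 * s * (s - 1))\<close> is the origin of the constant \<open>1 / 2\<close>.
\<close>
lemma theta_xi_eq_completed_zeta:
  assumes s: "Re s > 1"
  shows "theta_xi s = 1 / 2 * s * (s - 1) * of_real pi powr (- s / 2) * Gamma (s / 2) * (\<Sum>n. 1 / of_nat (Suc n) powr s)"
proof -
  let ?f = "\<lambda>u. exp (s * of_real u) * complex_of_real (psi u)"
  define M where "M = of_real pi powr (- s / 2) * Gamma (s / 2) / 2 * (\<Sum>n. 1 / of_nat (Suc n) powr s)"
  have s01: "s \<noteq> 0" "s - 1 \<noteq> 0" using s by auto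
  have int: "integrable lborel ?f" and val: "(LINT u|lborel. ?f u) = M"
    using psi_mellin[OF s] unfolding M_def by auto
  have int': "integrable lborel (\<lambda>u. ?f (- u))"
    using lborel_integrable_real_affine_iff[of "-1" ?f 0] int by simp
  have si: "set_integrable lborel {0..} ?f" "set_integrable lborel {0..} (\<lambda>u. ?f (- u))" "set_integrable lborel {..<0} ?f"
    unfolding set_integrable_def using int int' by (auto intro!: integrable_mult_indicator)
  have split: "M = (LINT u:{0..}|lborel. ?f u) + (LINT u:{..<0}|lborel. ?f u)"
  proof -
    have "M = (LINT u|lborel. indicator {0..} u *\<^sub>R ?f u + indicator {..<0} u *\<^sub>R ?f u)"
      unfolding val[symmetric] by (intro Bochner_Integration.integral_cong) (auto simp: indicator_def)
    also have "\<dots> = (LINT u:{0..}|lborel. ?f u) + (LINT u:{..<0}|lborel. ?f u)"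
      using si unfolding set_lebesgue_integral_def set_integrable_def by (intro Bochner_Integration.integral_add)
    finally show ?thesis .
  qed
  have flip: "(LINT u:{..<0}|lborel. ?f u) = (LINT u:{0..}|lborel. ?f (- u))"
  proof -
    have "(LINT u|lborel. indicator {..<0} u *\<^sub>R ?f u) = (LINT u|lborel. indicator {..<0} (- u) *\<^sub>R ?f (- u))"
      using lborel_integral_real_affine[of "-1" "\<lambda>u. indicator {..<0} u *\<^sub>R ?f u" 0] by simp
    also have "\<dots> = (LINT u|lborel. indicator {0..} u *\<^sub>R ?f (- u))"
    proof (rule integral_cong_AE)
      show "AE u in lborel. indicator {..<0} (- u) *\<^sub>R ?f (- u) = indicator {0..} u *\<^sub>R ?f (- u)"
        using AE_lborel_singleton[of 0] by eventually_elim (auto simp: indicator_def)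
      have "(\<lambda>u. ?f (- u)) \<in> borel_measurable lborel" using int' by (rule borel_measurable_integrable)
      then show "(\<lambda>u. indicator {..<0} (- u) *\<^sub>R ?f (- u)) \<in> borel_measurable lborel"
        "(\<lambda>u. indicator {0..} u *\<^sub>R ?f (- u)) \<in> borel_measurable lborel" by measurable
    qed
    finally show ?thesis unfolding set_lebesgue_integral_def .
  qed
  have M: "M = integral {0..} ?f + integral {0..} (\<lambda>u. ?f (- u))"
    unfolding split flip using si by (simp add: set_borel_integral_eq_integral)
  have i: "?f integrable_on {0..}" "(\<lambda>u. ?f (- u)) integrable_on {0..}"
    using si by (auto intro: set_borel_integral_eq_integral(1))
  have e: "((\<lambda>u. (exp (- (s - 1) * of_real u) - exp (- s * of_real u)) / 2) has_integral (1 / (s - 1) - 1 / s) / 2) {0..}"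
    using s by (intro has_integral_divide has_integral_diff has_integral_exp_complex_to_infinity) auto
  have "((\<lambda>u. ?f u + ?f (- u) - (exp (- (s - 1) * of_real u) - exp (- s * of_real u)) / 2) has_integral
      (integral {0..} ?f + integral {0..} (\<lambda>u. ?f (- u)) - (1 / (s - 1) - 1 / s) / 2)) {0..}"
    by (intro has_integral_add has_integral_diff e integrable_integral i)
  moreover have "?f u + ?f (- u) - (exp (- (s - 1) * of_real u) - exp (- s * of_real u)) / 2 = xi_kernel s u" for u
  proof -
    define A where "A = exp (s * of_real u)"
    define B where "B = exp (s * of_real (- u))"
    define P where "P = complex_of_real (psi u)"
    define e where "e = exp (complex_of_real u)"
    have 1: "exp (- (s - 1) * of_real u) = B * e" "exp ((1 - s) * of_real u) = B * e" "exp (- s * of_real u) = B"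
      by (simp_all add: B_def e_def algebra_simps flip: exp_add)
    have 2: "complex_of_real (psi (- u)) = e * P + (e - 1) / 2"
      by (simp add: psi_reflect e_def P_def exp_of_real)
    show ?thesis
      unfolding xi_kernel_def 1 2 A_def[symmetric] B_def[symmetric] P_def[symmetric] by (simp add: field_simps)
  qed
  ultimately have J: "integral {0..} (xi_kernel s) = M - (1 / (s - 1) - 1 / s) / 2"
    using M by (simp add: integral_unique)
  have "theta_xi s = s * (s - 1) * M"
    unfolding theta_xi_def J using s01 by (simp add: field_simps)
  then show ?thesis by (simp add: M_def)
qed

section \<open>The zeta-function and the xi-function\<close>

lemma Gamma_rGamma_cancel:
  assumes "z / 2 \<notin> \<int>\<^sub>\<le>\<^sub>0"
  shows "1 / 2 * z * Gamma (z / 2) * rGamma (z / 2 + 1) = 1"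
proof -
  have "Gamma (z / 2 + 1) = z / 2 * Gamma (z / 2)"
    by (rule Gamma_plus1[OF assms])
  moreover have "Gamma (z / 2) \<noteq> 0" "z \<noteq> 0" using assms by (auto simp: Gamma_eq_zero_iff)
  ultimately show ?thesis by (simp add: rGamma_inverse_Gamma field_simps)
qed

lemma half_notin_nonpos_Ints: "Re z > 0 \<Longrightarrow> z / 2 \<notin> \<int>\<^sub>\<le>\<^sub>0"
  by (auto elim!: nonpos_Ints_cases simp: field_simps)

text \<open>
  On the right, the factor \<open>s / 2 * Gamma (s / 2) = Gamma (s / 2 + 1)\<close> has been moved to the other side as
  the entire function \<open>rGamma\<close>, so the quotient is holomorphic off \<open>1\<close>; it agrees with the Dirichlet
  series, and by the identity theorem it is the only continuation. At \<open>s = 1\<close> the division by zero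
  produces the normalising value \<open>0\<close>.
\<close>
lemma riemann_zeta_eq:
  "riemann_zeta = (\<lambda>s. theta_xi s * of_real pi powr (s / 2) * rGamma (s / 2 + 1) / (s - 1))" (is "_ = ?Z")
  unfolding riemann_zeta_def
proof (rule the_equality)
  have hol: "?Z holomorphic_on - {1}"
    by (intro holomorphic_intros holomorphic_on_subset[OF holomorphic_theta_xi]) auto
  have Z: "(\<lambda>n. 1 / of_nat (Suc n) powr s) sums ?Z s" if s: "Re s > 1" for s
  proof -
    have "s \<noteq> 1" using s by auto
    have "theta_xi s * of_real pi powr (s / 2) * rGamma (s / 2 + 1) / (s - 1) = 
        (of_real pi powr (s / 2) * of_real pi powr (- s / 2)) * (1 / 2 * s * Gamma (s / 2) * rGamma (s / 2 + 1)) * (\<Sum>n. 1 / of_nat (Suc n) powr s)"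
      using \<open>s \<noteq> 1\<close> unfolding theta_xi_eq_completed_zeta[OF s] by (simp add: field_simps)
    also have "1 / 2 * s * Gamma (s / 2) * rGamma (s / 2 + 1) = 1"
      using s by (intro Gamma_rGamma_cancel half_notin_nonpos_Ints) simp
    also have "complex_of_real pi powr (s / 2) * of_real pi powr (- s / 2) = 1"
      by (simp flip: powr_add)
    finally have "?Z s = (\<Sum>n. 1 / of_nat (Suc n) powr s)" by simp
    then show ?thesis
      using summable_sums[OF summable_norm_cancel[OF summable_nat_powr_norm[OF s]]] by simp
  qed
  show "?Z holomorphic_on - {1} \<and> (\<forall>s. 1 < Re s \<longrightarrow> (\<lambda>n. 1 / of_nat (Suc n) powr s) sums ?Z s) \<and> ?Z 1 = 0"
    using hol Z by auto
  fix f assume f: "f holomorphic_on - {1} \<and> (\<forall>s. 1 < Re s \<longrightarrow> (\<lambda>n. 1 / of_nat (Suc n) powr s) sums f s) \<and> f 1 = 0"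
  show "f = ?Z"
  proof
    fix s
    show "f s = ?Z s"
    proof (cases "s = 1")
      case False
      show ?thesis
      proof (rule analytic_continuation_open[of "{s. Re s > 1}" "- {1}" f ?Z])
        show "open {s. Re s > 1}" by (rule open_halfspace_Re_gt)
        have "(2 :: complex) \<in> {s. Re s > 1}" by simp
        then show "{s. Re s > 1} \<noteq> {}" by blast
        show "connected (- {1 :: complex})" by (rule connected_punctured_universe) simp
        show "f holomorphic_on - {1}" using f by blast
        show "f z = ?Z z" if "z \<in> {s. Re s > 1}" for z
          using f Z[of z] that sums_unique2 by blast
      qed (use hol False in auto)
    qed (use f in auto)
  qed
qed

text \<open>
  The defining product equals \<open>theta_xi\<close> except at \<open>1\<close> and at the zeros of \<open>rGamma (z / 2)\<close>. These points are
  isolated, so the limits that remove the singularities are values of \<open>theta_xi\<close>.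
\<close>
lemma riemann_xi_eq: "riemann_xi = theta_xi"
proof
  fix z :: complex
  let ?f = "\<lambda>z. 1 / 2 * z * (z - 1) * of_real pi powr (- z / 2) * Gamma (z / 2) * riemann_zeta z"
  have "\<forall>\<^sub>F w :: complex in at z. rGamma (w / 2) \<noteq> 0 \<and> w \<in> UNIV"
    by (rule non_zero_neighbour_alt[where \<beta> = 2]) (auto intro!: holomorphic_intros)
  then have ev: "\<forall>\<^sub>F w in at z. theta_xi w = ?f w"
    using eventually_neq_at_within[of 1]
  proof eventually_elim
    fix w :: complex assume w: "rGamma (w / 2) \<noteq> 0 \<and> w \<in> UNIV" "w \<noteq> 1"
    have "?f w = (of_real pi powr (w / 2) * of_real pi powr (- w / 2)) * (1 / 2 * w * Gamma (w / 2) * rGamma (w / 2 + 1)) * theta_xi w"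
      using w by (simp add: riemann_zeta_eq field_simps)
    also have "1 / 2 * w * Gamma (w / 2) * rGamma (w / 2 + 1) = 1"
      using w by (intro Gamma_rGamma_cancel) (simp add: rGamma_eq_zero_iff)
    also have "complex_of_real pi powr (w / 2) * of_real pi powr (- w / 2) = 1"
      by (simp flip: powr_add)
    finally show "theta_xi w = ?f w" by simp
  qed
  have "theta_xi \<midarrow>z\<rightarrow> theta_xi z"
    using holomorphic_on_imp_continuous_on[OF holomorphic_theta_xi] by (simp add: continuous_on_def)
  then have "?f \<midarrow>z\<rightarrow> theta_xi z"
    by (rule tendsto_cong[OF ev, THEN iffD1])
  then show "riemann_xi z = theta_xi z"
    unfolding riemann_xi_def by (rule remove_sings_eqI)
qed

section \<open>Location and number of the zeros\<close>

text \<open>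
  The first term \<open>1\<close> of the Dirichlet series dominates: the sum of the others is at most \<open>1 / 2\<close> by
  comparison with the telescoping series of \<open>1 / (n * (n + 1))\<close>.
\<close>
lemma theta_xi_nonzero_right:
  assumes s: "Re s \<ge> 3"
  shows "theta_xi s \<noteq> 0"
proof -
  let ?a = "\<lambda>n. 1 / complex_of_nat (Suc n) powr s"
  have sn: "summable (\<lambda>n. norm (?a n))" using s by (intro summable_nat_powr_norm) simp
  have "(\<lambda>n. 1 / real (Suc n)) \<longlonglongrightarrow> 0"
    using LIMSEQ_inverse_real_of_nat by (simp add: divide_inverse)
  from telescope_sums'[OF this] have t: "(\<lambda>n. 1 / real (Suc n) - 1 / real (Suc (Suc n))) sums 1" by simp
  have le: "norm (?a (Suc n)) \<le> 1 / 2 * (1 / real (Suc n) - 1 / real (Suc (Suc n)))" for n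
  proof -
    define x where "x = real (Suc n)"
    have x: "x \<ge> 1" by (simp add: x_def)
    have "norm (?a (Suc n)) = 1 / (x + 1) powr (Re s)"
      unfolding norm_divide norm_nat_powr x_def by (simp add: add_ac)
    also have "\<dots> \<le> 1 / (x + 1) powr 3"
      using s x by (intro divide_left_mono powr_mono mult_pos_pos) auto
    also have "\<dots> = 1 / (x + 1) ^ 3" using x by (simp add: powr_numeral)
    also have "\<dots> \<le> 1 / (2 * (x * (x + 1)))"
    proof (rule divide_left_mono)
      have "2 * x \<le> (x + 1)\<^sup>2" by (simp add: power2_eq_square algebra_simps)
      then have "2 * x * (x + 1) \<le> (x + 1)\<^sup>2 * (x + 1)" using x by (intro mult_right_mono) auto
      then show "2 * (x * (x + 1)) \<le> (x + 1) ^ 3" by (simp add: power2_eq_square power3_eq_cube mult_ac)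
    qed (use x in auto)
    also have "\<dots> = 1 / 2 * (1 / x - 1 / (x + 1))" using x by (simp add: field_simps)
    finally show ?thesis by (simp add: x_def add_ac)
  qed
  have s1: "summable (\<lambda>n. norm (?a (Suc n)))" using sn by (subst summable_Suc_iff)
  then have "norm (\<Sum>n. ?a (Suc n)) \<le> (\<Sum>n. norm (?a (Suc n)))"
    by (rule summable_norm)
  also have "\<dots> \<le> (\<Sum>n. 1 / 2 * (1 / real (Suc n) - 1 / real (Suc (Suc n))))"
    by (intro suminf_le le s1 summable_mult sums_summable[OF t])
  also have "\<dots> = 1 / 2" using sums_mult[OF t, of "1 / 2"] by (simp add: sums_iff)
  finally have 1: "norm (\<Sum>n. ?a (Suc n)) \<le> 1 / 2" .
  have 2: "(\<Sum>n. ?a n) = ?a 0 + (\<Sum>n. ?a (Suc n))"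
    using suminf_split_head[OF summable_norm_cancel[OF sn]] by simp
  have 3: "(\<Sum>n. ?a n) \<noteq> 0"
  proof
    assume "(\<Sum>n. ?a n) = 0"
    with 2 have "1 + (\<Sum>n. ?a (Suc n)) = 0" by simp
    then have "(\<Sum>n. ?a (Suc n)) = - 1" by (simp only: add_eq_0_iff)
    with 1 show False by simp
  qed
  have "Gamma (s / 2) \<noteq> 0" "s \<noteq> 0" "s - 1 \<noteq> 0"
    using s half_notin_nonpos_Ints[of s] by (auto simp: Gamma_eq_zero_iff)
  with 3 show ?thesis using s by (subst theta_xi_eq_completed_zeta) auto
qed

text \<open>
  By reflection the zero-free half-plane on the right has a mirror image on the left.
\<close>
lemma theta_xi_zero_strip:
  assumes "theta_xi \<rho> = 0"
  shows "\<bar>Re \<rho>\<bar> \<le> 3"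
proof -
  have "Re \<rho> < 3" using theta_xi_nonzero_right[of \<rho>] assms by force
  moreover have "Re (1 - \<rho>) < 3" using theta_xi_nonzero_right[of "1 - \<rho>"] assms by (force simp: theta_xi_reflect)
  ultimately show ?thesis by simp
qed

text \<open>
  The zeros are divided out one at a time. Near a new zero \<open>a\<close> the quotient is redefined by means of the
  local factorisation \<open>zor_poly f a\<close>, which the earlier factors do not disturb since they do not vanish
  at \<open>a\<close>.
\<close>
lemma entire_factor_zeros:
  assumes f: "f holomorphic_on UNIV" "\<exists>w. f w \<noteq> 0" and S: "finite S"
  shows "\<exists>g. g holomorphic_on UNIV \<and> (\<forall>z. f z = g z * (\<Prod>\<rho>\<in>S. (z - \<rho>) ^ nat (zorder f \<rho>)))"
  using S
proof (induction S rule: finite_induct)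
  case empty
  then show ?case using f by auto
next
  case (insert a S)
  then obtain g where g: "g holomorphic_on UNIV" "\<And>z. f z = g z * (\<Prod>\<rho>\<in>S. (z - \<rho>) ^ nat (zorder f \<rho>))"
    by blast
  define P where "P z = (\<Prod>\<rho>\<in>S. (z - \<rho>) ^ nat (zorder f \<rho>))" for z
  define m where "m = nat (zorder f a)"
  have "\<exists>w\<in>UNIV. f w \<noteq> 0" using f(2) by simp
  from zorder_exist_zero[OF f(1) open_UNIV connected_UNIV UNIV_I this, of a]
  obtain r where r: "r > 0" "zor_poly f a holomorphic_on cball a r"
     "\<forall>w\<in>cball a r. f w = zor_poly f a w * (w - a) ^ m \<and> zor_poly f a w \<noteq> 0"
    unfolding m_def by blast
  have "open (- S)" "a \<in> - S" using insert finite_imp_closed by auto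
  then obtain d where d: "d > 0" "ball a d \<subseteq> - S" using openE by blast
  define B where "B = ball a (min r d)"
  have B: "open B" "a \<in> B" "B \<subseteq> cball a r" "B \<subseteq> - S" using r(1) d by (auto simp: B_def)
  have P0: "P w \<noteq> 0" if "w \<in> B" for w
    using that B insert.hyps(1) unfolding P_def by auto
  have holP: "P holomorphic_on A" for A
    unfolding P_def[abs_def] by (intro holomorphic_intros)
  define h where "h z = (if z \<in> B then zor_poly f a z / P z else g z / (z - a) ^ m)" for z
  have h: "h z = g z / (z - a) ^ m" if "z \<noteq> a" for z
  proof (cases "z \<in> B")
    case True
    then have "g z * P z = zor_poly f a z * (z - a) ^ m"
      using bspec[OF r(3), of z] g(2)[of z] B by (auto simp: P_def)
    then show ?thesis using True P0[OF True] that by (simp add: h_def field_simps)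
  qed (simp add: h_def)
  have "h holomorphic_on (B \<union> - {a})"
  proof (rule holomorphic_on_Un)
    have "(\<lambda>z. zor_poly f a z / P z) holomorphic_on B"
      using P0 B by (intro holomorphic_intros holP holomorphic_on_subset[OF r(2)]) auto
    then show "h holomorphic_on B" by (rule holomorphic_transform) (simp add: h_def)
    have "(\<lambda>z. g z / (z - a) ^ m) holomorphic_on - {a}"
      by (intro holomorphic_intros holomorphic_on_subset[OF g(1)]) auto
    then show "h holomorphic_on - {a}" by (rule holomorphic_transform) (simp add: h)
  qed (use B in auto)
  moreover have "B \<union> - {a} = UNIV" using B by auto
  ultimately have "h holomorphic_on UNIV" by simp
  moreover have "f z = h z * (\<Prod>\<rho>\<in>insert a S. (z - \<rho>) ^ nat (zorder f \<rho>))" for z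
  proof -
    have "f z = h z * ((z - a) ^ m * P z)"
    proof (cases "z = a")
      case True
      then show ?thesis using bspec[OF r(3), of a] r(1) P0[OF B(2)] B(2) by (simp add: h_def)
    next
      case False
      then show ?thesis using g(2)[of z] by (simp add: h P_def)
    qed
    then show ?thesis using insert.hyps by (simp add: P_def m_def)
  qed
  ultimately show ?case by blast
qed

text \<open>
  A crude form of Jensen's inequality. After the zeros are divided out, every factor satisfies
  \<open>norm (z - \<rho>) \<ge> 2 * norm \<rho>\<close> on the circle of radius \<open>3 * r\<close>, so by the maximum principle each zero
  costs a factor \<open>2\<close> between the value at \<open>0\<close> and the maximum on the circle.
\<close>
lemma entire_zero_count:
  assumes f: "f holomorphic_on UNIV" "f 0 \<noteq> 0" and S: "finite S" "\<And>\<rho>. \<rho> \<in> S \<Longrightarrow> f \<rho> = 0 \<and> norm \<rho> \<le> r"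
    and r: "r > 0" and M: "\<And>z. norm z = 3 * r \<Longrightarrow> norm (f z) \<le> M"
  shows "norm (f 0) * 2 ^ (\<Sum>\<rho>\<in>S. nat (zorder f \<rho>)) \<le> M"
proof -
  obtain g where g: "g holomorphic_on UNIV" "\<And>z. f z = g z * (\<Prod>\<rho>\<in>S. (z - \<rho>) ^ nat (zorder f \<rho>))"
    using entire_factor_zeros[of f S] f S(1) by blast
  define n where "n = (\<Sum>\<rho>\<in>S. nat (zorder f \<rho>))"
  define Q where "Q = (\<Prod>\<rho>\<in>S. norm \<rho> ^ nat (zorder f \<rho>))"
  have "Q > 0" unfolding Q_def using S(2) f(2) by (intro prod_pos zero_less_power) auto
  have 0: "norm (f 0) = norm (g 0) * Q"
    by (simp add: g(2)[of 0] norm_mult Q_def norm_power flip: prod_norm)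
  have g_le: "norm (g z) \<le> M / (2 ^ n * Q)" if z: "norm z = 3 * r" for z
  proof -
    have "2 ^ n * Q = (\<Prod>\<rho>\<in>S. (2 * norm \<rho>) ^ nat (zorder f \<rho>))"
      by (simp add: n_def Q_def power_sum power_mult_distrib prod.distrib)
    also have "\<dots> \<le> (\<Prod>\<rho>\<in>S. norm (z - \<rho>) ^ nat (zorder f \<rho>))"
    proof (intro prod_mono conjI power_mono)
      fix \<rho> assume "\<rho> \<in> S"
      then have "norm \<rho> \<le> r" using S(2) by auto
      then show "2 * norm \<rho> \<le> norm (z - \<rho>)" using norm_triangle_ineq2[of z \<rho>] z by linarith
    qed auto
    finally have "norm (g z) * (2 ^ n * Q) \<le> norm (g z) * (\<Prod>\<rho>\<in>S. norm (z - \<rho>) ^ nat (zorder f \<rho>))"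
      by (intro mult_left_mono) auto
    also have "\<dots> = norm (f z)"
      by (simp add: g(2)[of z] norm_mult norm_power flip: prod_norm)
    also have "\<dots> \<le> M" by (rule M[OF z])
    finally show ?thesis using \<open>Q > 0\<close> by (simp add: field_simps)
  qed
  have "norm (g 0) \<le> M / (2 ^ n * Q)"
  proof (rule maximum_modulus_frontier[of g "ball 0 (3 * r)"])
    show "g holomorphic_on interior (ball 0 (3 * r))" by (rule holomorphic_on_subset[OF g(1)]) auto
    show "continuous_on (closure (ball 0 (3 * r))) g"
      by (rule continuous_on_subset[OF holomorphic_on_imp_continuous_on[OF g(1)]]) auto
  qed (use r g_le in \<open>auto simp: frontier_ball\<close>)
  then show ?thesis using \<open>Q > 0\<close> unfolding 0 n_def[symmetric] by (simp add: field_simps)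
qed

lemma theta_xi_0: "theta_xi 0 = 1 / 2"
  by (simp add: theta_xi_def)

text \<open>
  The logarithm of a bound of order \<open>k\<^sup>2 * fact k\<close>, estimated through \<open>fact k \<le> k ^ k\<close>.
\<close>
lemma log2_factorial_bound:
  fixes N j k :: nat
  assumes k3: "3 \<le> k" and kj: "k \<le> 2 ^ (j + 2)" and N: "2 ^ N \<le> 1 + 8 * (k * (k + 1) * fact k)"
  shows "N \<le> 4 + (j + 2) * (k + 2)"
proof -
  have "k * (k + 1) * fact k \<le> k * (k + 1) * k ^ k"
    using fact_le_power[of k, where ?'a = nat] by (intro mult_left_mono) auto
  moreover have "1 + 8 * (k * (k + 1) * k ^ k) \<le> 16 * (k * k * k ^ k)"
  proof -
    have "3 * k \<le> k * k" using k3 by (intro mult_right_mono) auto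
    then have "1 + 8 * (k * (k + 1)) \<le> 16 * (k * k)" using k3 unfolding distrib_left by linarith
    then have "(1 + 8 * (k * (k + 1))) * k ^ k \<le> 16 * (k * k) * k ^ k" by (rule mult_right_mono) simp
    moreover have "1 \<le> k ^ k" using k3 by simp
    ultimately show ?thesis by (simp add: algebra_simps)
  qed
  ultimately have "2 ^ N \<le> 16 * (k * k * k ^ k)" using N by linarith
  also have "16 * (k * k * k ^ k) = 2 ^ 4 * k ^ (k + 2)" by (simp add: power_add power2_eq_square)
  also have "\<dots> \<le> 2 ^ 4 * (2 ^ (j + 2)) ^ (k + 2)"
    by (rule mult_left_mono[OF power_mono[OF kj]]) simp_all
  finally have "(2::nat) ^ N \<le> 2 ^ (4 + (j + 2) * (k + 2))"
    unfolding power_add[of 2 4] power_mult .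
  then show ?thesis by (rule power_le_imp_le_exp[rotated]) simp
qed

text \<open>
  The number of zeros of modulus at most \<open>r = 2 ^ j\<close> is of order \<open>r * ln r\<close>: on the circle of radius
  \<open>3 * r\<close> the growth bound for \<open>theta_xi\<close> applies with \<open>k = 3 * r\<close>.
\<close>
lemma theta_xi_zero_count:
  fixes j :: nat
  assumes S: "finite S" "\<And>\<rho>. \<rho> \<in> S \<Longrightarrow> theta_xi \<rho> = 0 \<and> norm \<rho> \<le> 2 ^ j"
  shows "(\<Sum>\<rho>\<in>S. nat (zorder theta_xi \<rho>)) \<le> 4 + (j + 2) * (3 * 2 ^ j + 2)"
proof (rule log2_factorial_bound)
  let ?N = "\<Sum>\<rho>\<in>S. nat (zorder theta_xi \<rho>)" and ?k = "3 * 2 ^ j :: nat"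
  have "1 \<le> (2::real) ^ j" by simp
  then have k2: "3 * 2 ^ j + 2 \<le> 2 * real ?k" by (simp, linarith)
  have "norm (theta_xi 0) * 2 ^ ?N \<le> 1 / 2 + real ?k * (real ?k + 1) * (4 * fact ?k)"
  proof (rule entire_zero_count[where r = "2 ^ j"])
    fix z :: complex assume "norm z = 3 * 2 ^ j"
    then have "norm z = real ?k" "norm z + 2 \<le> 2 * real ?k" using k2 by simp_all
    then show "norm (theta_xi z) \<le> 1 / 2 + real ?k * (real ?k + 1) * (4 * fact ?k)"
      using theta_xi_norm_le[of z ?k] by (simp only:)
  qed (use S in \<open>auto simp: holomorphic_theta_xi theta_xi_0\<close>)
  then have "real (2 ^ ?N) \<le> real (1 + 8 * (?k * (?k + 1) * fact ?k))"
    by (simp add: theta_xi_0 ring_distribs del: of_nat_sum)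
  then show "2 ^ ?N \<le> 1 + 8 * (?k * (?k + 1) * fact ?k)" by (rule of_nat_le_iff[THEN iffD1])
qed simp_all

section \<open>Summability over the zeros\<close>

definition xi_zeros :: "complex set" where "xi_zeros = {\<rho>. theta_xi \<rho> = 0}"

definition xi_mult :: "complex \<Rightarrow> real" where "xi_mult \<rho> = of_int (zorder theta_xi \<rho>)"

lemma zorder_theta_xi_nonneg: "zorder theta_xi \<rho> \<ge> 0" "theta_xi \<rho> = 0 \<Longrightarrow> zorder theta_xi \<rho> > 0"
proof -
  have "\<exists>w\<in>UNIV. theta_xi w \<noteq> 0" using theta_xi_0 by (intro bexI[of _ 0]) auto
  from zorder_exist_zero[OF holomorphic_theta_xi open_UNIV connected_UNIV UNIV_I this, of \<rho>]
  show "zorder theta_xi \<rho> \<ge> 0" "theta_xi \<rho> = 0 \<Longrightarrow> zorder theta_xi \<rho> > 0" by (auto split: if_splits)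
qed

lemma xi_mult_nonneg: "xi_mult \<rho> \<ge> 0"
  using zorder_theta_xi_nonneg(1)[of \<rho>] by (simp add: xi_mult_def)

lemma xi_mult_ge_1: "\<rho> \<in> xi_zeros \<Longrightarrow> xi_mult \<rho> \<ge> 1"
  using zorder_theta_xi_nonneg(2)[of \<rho>] by (simp add: xi_mult_def xi_zeros_def)

lemma xi_zeros_cnj: "cnj \<rho> \<in> xi_zeros \<longleftrightarrow> \<rho> \<in> xi_zeros"
  by (simp add: xi_zeros_def theta_xi_cnj)

lemma xi_zeros_reflect: "1 - \<rho> \<in> xi_zeros \<longleftrightarrow> \<rho> \<in> xi_zeros"
  by (simp add: xi_zeros_def theta_xi_reflect)

text \<open>
  Conjugating the local factorisation at \<open>\<rho>\<close> gives the one at \<open>cnj \<rho>\<close>.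
\<close>
lemma xi_mult_cnj: "xi_mult (cnj \<rho>) = xi_mult \<rho>"
proof -
  define n where "n = nat (zorder theta_xi \<rho>)"
  have ne: "\<exists>w\<in>UNIV. theta_xi w \<noteq> 0" using theta_xi_0 by (intro bexI[of _ 0]) auto
  from zorder_exist_zero[OF holomorphic_theta_xi open_UNIV connected_UNIV UNIV_I ne, of \<rho>]
  obtain r where r: "r > 0" "zor_poly theta_xi \<rho> holomorphic_on cball \<rho> r"
    "\<forall>w\<in>cball \<rho> r. theta_xi w = zor_poly theta_xi \<rho> w * (w - \<rho>) ^ n \<and> zor_poly theta_xi \<rho> w \<noteq> 0"
    unfolding n_def by blast
  let ?h = "cnj \<circ> zor_poly theta_xi \<rho> \<circ> cnj"
  have im: "cnj ` ball (cnj \<rho>) r \<subseteq> ball \<rho> r"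
  proof
    fix w assume "w \<in> cnj ` ball (cnj \<rho>) r"
    then obtain v where v: "w = cnj v" "norm (cnj \<rho> - v) < r" by (auto simp: dist_norm)
    have "norm (\<rho> - w) = norm (cnj (\<rho> - w))" by (simp only: complex_mod_cnj)
    with v show "w \<in> ball \<rho> r" by (simp add: dist_norm)
  qed
  have "zorder theta_xi (cnj \<rho>) = int n"
  proof (rule zorder_eqI[where S = "ball (cnj \<rho>) r" and g = ?h])
    have "cnj ` ball (cnj \<rho>) r = ball \<rho> r"
    proof
      show "ball \<rho> r \<subseteq> cnj ` ball (cnj \<rho>) r"
      proof
        fix w assume "w \<in> ball \<rho> r"
        moreover have "norm (\<rho> - w) = norm (cnj (\<rho> - w))" by (simp only: complex_mod_cnj)
        ultimately have "cnj w \<in> ball (cnj \<rho>) r" by (simp add: dist_norm)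
        then have "cnj (cnj w) \<in> cnj ` ball (cnj \<rho>) r" by (rule imageI)
        then show "w \<in> cnj ` ball (cnj \<rho>) r" by simp
      qed
    qed (rule im)
    then show "?h holomorphic_on ball (cnj \<rho>) r"
      by (intro holomorphic_on_compose_cnj_cnj) (auto intro: holomorphic_on_subset[OF r(2)])
    show "?h (cnj \<rho>) \<noteq> 0" using r(1) bspec[OF r(3), of \<rho>] by simp
    fix w assume "w \<in> ball (cnj \<rho>) r"
    then have "cnj w \<in> ball \<rho> r" using im by blast
    then have "cnj w \<in> cball \<rho> r" by simp
    then have "cnj (theta_xi (cnj w)) = cnj (zor_poly theta_xi \<rho> (cnj w) * (cnj w - \<rho>) ^ n)"
      using bspec[OF r(3)] by simp
    then show "theta_xi w = ?h w * (w - cnj \<rho>) powi (int n)"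
      by (simp add: theta_xi_cnj)
  qed (use r in auto)
  then show ?thesis using zorder_theta_xi_nonneg(1)[of \<rho>] by (simp add: xi_mult_def n_def)
qed

lemma xi_zero_not_real: "\<rho> \<in> xi_zeros \<Longrightarrow> Im \<rho> \<noteq> 0"
proof
  assume "\<rho> \<in> xi_zeros" "Im \<rho> = 0"
  moreover from this have "\<rho> = of_real (Re \<rho>)" by (simp add: complex_eq_iff)
  ultimately show False using theta_xi_real_nonzero[of "Re \<rho>"] by (simp add: xi_zeros_def)
qed

lemma summable_dyadic_weights: "summable (\<lambda>j. (4 / 4 ^ j) * (4 + (real j + 2) * (3 * 2 ^ j + 2)))"
proof (rule summable_comparison_test)
  have "summable (\<lambda>j. 36 * (of_nat (Suc j) * (1 / 2) ^ j) + 36 * (1 / 2 :: real) ^ j)"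
    by (intro summable_add summable_mult summable_geometric sums_summable[OF geometric_deriv_sums]) auto
  then show "summable (\<lambda>j. (real j + 2) * 36 * (1 / 2) ^ j)" by (simp add: algebra_simps)
  have "(4 / 4 ^ j) * (4 + (real j + 2) * (3 * 2 ^ j + 2)) \<le> (real j + 2) * 36 * (1 / 2) ^ j" for j
  proof -
    have t: "(2::real) ^ j \<ge> 1" by simp
    have "4 \<le> (real j + 2) * (2 * 2 ^ j)" using mult_mono[of 2 "real j + 2" 2 "2 * 2 ^ j"] t by simp
    moreover have "(real j + 2) * (3 * 2 ^ j + 2) \<le> (real j + 2) * (5 * 2 ^ j)" using t by (intro mult_left_mono) auto
    ultimately have "4 + (real j + 2) * (3 * 2 ^ j + 2) \<le> (real j + 2) * (9 * 2 ^ j)" using t by (simp add: algebra_simps)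
    then have "(4 / 4 ^ j) * (4 + (real j + 2) * (3 * 2 ^ j + 2)) \<le> (4 / 4 ^ j) * ((real j + 2) * (9 * 2 ^ j))"
      by (rule mult_left_mono) simp
    also have "\<dots> = (real j + 2) * 36 * (1 / 2) ^ j"
    proof -
      have "(4::real) ^ j = 2 ^ j * 2 ^ j" by (simp flip: power_mult_distrib)
      then show ?thesis by (simp add: field_simps)
    qed
    finally show ?thesis .
  qed
  then show "\<exists>N. \<forall>j\<ge>N. norm ((4 / 4 ^ j) * (4 + (real j + 2) * (3 * 2 ^ j + 2))) \<le> (real j + 2) * 36 * (1 / 2) ^ j"
    by (intro exI[of _ 0]) (simp add: abs_of_nonneg)
qed

text \<open>
  The weight of a point is paid for by the first dyadic disc that contains it; the larger discs
  only add to the right-hand side. Summing over discs instead of annuli makes the exchange of the order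
  of summation over points and discs immediate.
\<close>
lemma dyadic_weight:
  assumes "(x::real) \<le> 2 ^ J" "0 \<le> x"
  shows "1 / (1 + x)\<^sup>2 \<le> (\<Sum>j\<le>J. if x \<le> 2 ^ j then 4 / 4 ^ j else 0)"
proof -
  define i where "i = (LEAST j. x \<le> 2 ^ j)"
  have i: "x \<le> 2 ^ i" unfolding i_def by (rule LeastI[of _ J]) (rule assms)
  have "i \<le> J" unfolding i_def by (rule Least_le) (rule assms)
  have "1 / (1 + x)\<^sup>2 \<le> 4 / 4 ^ i"
  proof (cases i)
    case 0
    have "1 \<le> (1 + x)\<^sup>2" using assms by (intro one_le_power) auto
    then have "1 / (1 + x)\<^sup>2 \<le> 1 / 1" using assms by (intro divide_left_mono) auto
    then show ?thesis using 0 by simp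
  next
    case (Suc l)
    have "\<not> x \<le> 2 ^ l" using not_less_Least[of l "\<lambda>j. x \<le> 2 ^ j"] Suc i_def by auto
    then have "(2 ^ l)\<^sup>2 \<le> (1 + x)\<^sup>2" using assms by (intro power_mono) auto
    moreover have "((2::real) ^ l)\<^sup>2 = 4 ^ l" by (simp add: power2_eq_square flip: power_mult_distrib)
    ultimately have "4 ^ l \<le> (1 + x)\<^sup>2" by simp
    then have "1 / (1 + x)\<^sup>2 \<le> 1 / 4 ^ l" by (intro divide_left_mono mult_pos_pos) (use assms in auto)
    then show ?thesis using Suc by simp
  qed
  also have "\<dots> = (\<Sum>j\<in>{i}. if x \<le> 2 ^ j then 4 / 4 ^ j else 0)" using i by simp
  also have "\<dots> \<le> (\<Sum>j\<le>J. if x \<le> 2 ^ j then 4 / 4 ^ j else 0)"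
    using \<open>i \<le> J\<close> by (intro sum_mono2) auto
  finally show ?thesis .
qed

text \<open>
  The counting bound, of order \<open>j * 2 ^ j\<close> for the disc of radius \<open>2 ^ j\<close>, is summed against the
  weights \<open>4 / 4 ^ j\<close>.
\<close>
lemma summable_xi_zeros: "(\<lambda>\<rho>. xi_mult \<rho> / (1 + norm \<rho>)\<^sup>2) summable_on xi_zeros"
proof (rule nonneg_bdd_above_summable_on)
  show "xi_mult \<rho> / (1 + norm \<rho>)\<^sup>2 \<ge> 0" for \<rho> by (simp add: xi_mult_nonneg)
  let ?c = "\<lambda>j. (4 / 4 ^ j) * (4 + (real j + 2) * (3 * 2 ^ j + 2))"
  have "(\<Sum>\<rho>\<in>F. xi_mult \<rho> / (1 + norm \<rho>)\<^sup>2) \<le> suminf ?c" if F: "F \<subseteq> xi_zeros" "finite F" for F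
  proof -
    have "bdd_above (norm ` F)" using F(2) by simp
    then obtain b where b: "\<And>\<rho>. \<rho> \<in> F \<Longrightarrow> norm \<rho> \<le> b" by (auto simp: bdd_above_def)
    obtain J where "b < 2 ^ J" using real_arch_pow[of 2 b] by auto
    with b have J: "norm \<rho> \<le> 2 ^ J" if "\<rho> \<in> F" for \<rho> using that by force
    have "(\<Sum>\<rho>\<in>F. xi_mult \<rho> / (1 + norm \<rho>)\<^sup>2) \<le> (\<Sum>\<rho>\<in>F. \<Sum>j\<le>J. xi_mult \<rho> * (if norm \<rho> \<le> 2 ^ j then 4 / 4 ^ j else 0))"
    proof (rule sum_mono)
      fix \<rho> assume "\<rho> \<in> F"
      from mult_left_mono[OF dyadic_weight[OF J[OF this]] xi_mult_nonneg[of \<rho>]]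
      show "xi_mult \<rho> / (1 + norm \<rho>)\<^sup>2 \<le> (\<Sum>j\<le>J. xi_mult \<rho> * (if norm \<rho> \<le> 2 ^ j then 4 / 4 ^ j else 0))"
        by (simp add: sum_distrib_left)
    qed
    also have "\<dots> = (\<Sum>j\<le>J. \<Sum>\<rho>\<in>F. xi_mult \<rho> * (if norm \<rho> \<le> 2 ^ j then 4 / 4 ^ j else 0))"
      by (rule sum.swap)
    also have "\<dots> \<le> (\<Sum>j\<le>J. ?c j)"
    proof (rule sum_mono)
      fix j
      let ?S = "{\<rho>\<in>F. norm \<rho> \<le> 2 ^ j}"
      have "(\<Sum>\<rho>\<in>F. xi_mult \<rho> * (if norm \<rho> \<le> 2 ^ j then 4 / 4 ^ j else 0)) = (\<Sum>\<rho>\<in>?S. xi_mult \<rho> * (4 / 4 ^ j))"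
        using F(2) by (subst sum.inter_filter) (auto intro!: sum.cong)
      also have "\<dots> = (4 / 4 ^ j) * real (\<Sum>\<rho>\<in>?S. nat (zorder theta_xi \<rho>))"
        by (simp add: sum_distrib_left sum_distrib_right xi_mult_def zorder_theta_xi_nonneg mult.commute)
      also have "\<dots> \<le> (4 / 4 ^ j) * real (4 + (j + 2) * (3 * 2 ^ j + 2))" (is "_ \<le> _ * real ?n")
        using F by (intro mult_left_mono of_nat_mono theta_xi_zero_count) (auto simp: xi_zeros_def)
      also have "real ?n = 4 + (real j + 2) * (3 * 2 ^ j + 2)" by (simp add: ring_distribs)
      finally show "(\<Sum>\<rho>\<in>F. xi_mult \<rho> * (if norm \<rho> \<le> 2 ^ j then 4 / 4 ^ j else 0)) \<le> ?c j" .
    qed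
    also have "\<dots> \<le> suminf ?c"
      by (rule sum_le_suminf[OF summable_dyadic_weights]) auto
    finally show ?thesis .
  qed
  then show "bdd_above (sum (\<lambda>\<rho>. xi_mult \<rho> / (1 + norm \<rho>)\<^sup>2) ` {F. F \<subseteq> xi_zeros \<and> finite F})"
    by (intro bdd_aboveI[of _ "suminf ?c"]) auto
qed

lemma finite_xi_zeros_cball: "finite {\<rho>\<in>xi_zeros. norm \<rho> \<le> R}"
proof -
  have "finite {\<rho>\<in>cball 0 R. theta_xi \<rho> = 0}"
  proof (cases "theta_xi constant_on UNIV")
    case True
    then obtain c where c: "theta_xi \<rho> = c" for \<rho> unfolding constant_on_def by blast
    have "theta_xi \<rho> = theta_xi 0" for \<rho> by (simp only: c)
    then have "theta_xi \<rho> \<noteq> 0" for \<rho> by (simp only: theta_xi_0) simp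
    then show ?thesis by simp
  next
    case False
    then show ?thesis by (intro holomorphic_compact_finite_zeros[OF holomorphic_theta_xi]) auto
  qed
  moreover have "{\<rho>\<in>cball 0 R. theta_xi \<rho> = 0} = {\<rho>\<in>xi_zeros. norm \<rho> \<le> R}" by (auto simp: xi_zeros_def)
  ultimately show ?thesis by simp
qed

lemma finite_xi_zeros_height: "finite {\<rho>\<in>xi_zeros. \<bar>Im \<rho>\<bar> \<le> T}"
proof (rule finite_subset[OF _ finite_xi_zeros_cball[of "3 + T"]])
  show "{\<rho>\<in>xi_zeros. \<bar>Im \<rho>\<bar> \<le> T} \<subseteq> {\<rho>\<in>xi_zeros. norm \<rho> \<le> 3 + T}"
  proof clarsimp
    fix \<rho> assume "\<rho> \<in> xi_zeros" "\<bar>Im \<rho>\<bar> \<le> T"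
    then show "norm \<rho> \<le> 3 + T"
      using theta_xi_zero_strip[of \<rho>] cmod_le[of \<rho>] by (simp add: xi_zeros_def)
  qed
qed

text \<open>
  The zeros up to height \<open>T\<close> are closed under conjugation, so every partial sum is real and equals the
  partial sum of the real parts. These are absolutely summable, and the truncations exhaust the set
  of zeros.
\<close>
lemma has_xi_zeros_sum_real:
  assumes cnj: "\<And>\<rho>. \<rho> \<in> xi_zeros \<Longrightarrow> f (cnj \<rho>) = cnj (f \<rho>)"
    and sum: "(\<lambda>\<rho>. xi_mult \<rho> * Re (f \<rho>)) summable_on xi_zeros"
  shows "has_xi_zeros_sum f (of_real (\<Sum>\<^sub>\<infinity>\<rho>\<in>xi_zeros. xi_mult \<rho> * Re (f \<rho>)))"
proof -
  let ?Z = "\<lambda>T. {\<rho>\<in>xi_zeros. \<bar>Im \<rho>\<bar> \<le> T}"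
  have ps: "xi_zeros_partial_sum f T = of_real (\<Sum>\<rho>\<in>?Z T. xi_mult \<rho> * Re (f \<rho>))" for T
  proof -
    define S where "S = (\<Sum>\<rho>\<in>?Z T. of_real (xi_mult \<rho>) * f \<rho>)"
    have "xi_zeros_partial_sum f T = S"
      by (simp add: xi_zeros_partial_sum_def S_def riemann_xi_eq xi_zeros_def xi_mult_def)
    have "S = (\<Sum>\<rho>\<in>?Z T. of_real (xi_mult (cnj \<rho>)) * f (cnj \<rho>))"
      unfolding S_def by (rule sum.reindex_bij_witness[of _ cnj cnj]) (auto simp: xi_zeros_cnj)
    also have "\<dots> = cnj S"
      unfolding S_def by (auto simp: xi_mult_cnj cnj intro!: sum.cong)
    finally have "Im S = 0" by (metis Reals_cnj_iff complex_is_Real_iff)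
    moreover have "Re S = (\<Sum>\<rho>\<in>?Z T. xi_mult \<rho> * Re (f \<rho>))" by (simp add: S_def)
    ultimately show ?thesis using \<open>xi_zeros_partial_sum f T = S\<close> by (simp add: complex_eq_iff)
  qed
  have "filterlim ?Z (finite_subsets_at_top xi_zeros) at_top"
    unfolding filterlim_finite_subsets_at_top
  proof (intro allI impI)
    fix X :: "complex set" assume X: "finite X \<and> X \<subseteq> xi_zeros"
    then have "bdd_above ((\<lambda>\<rho>. \<bar>Im \<rho>\<bar>) ` X)" by simp
    then obtain b where b: "\<And>\<rho>. \<rho> \<in> X \<Longrightarrow> \<bar>Im \<rho>\<bar> \<le> b" by (auto simp: bdd_above_def)
    show "\<forall>\<^sub>F T in at_top. finite (?Z T) \<and> X \<subseteq> ?Z T \<and> ?Z T \<subseteq> xi_zeros"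
      using eventually_ge_at_top[of b]
    proof eventually_elim
      fix T assume "b \<le> T"
      then show "finite (?Z T) \<and> X \<subseteq> ?Z T \<and> ?Z T \<subseteq> xi_zeros"
        using X b finite_xi_zeros_height[of T] by force
    qed
  qed
  then have "((\<lambda>T. \<Sum>\<rho>\<in>?Z T. xi_mult \<rho> * Re (f \<rho>)) \<longlongrightarrow> (\<Sum>\<^sub>\<infinity>\<rho>\<in>xi_zeros. xi_mult \<rho> * Re (f \<rho>))) at_top"
    using has_sum_infsum[OF sum] unfolding has_sum_def by (rule filterlim_compose[rotated])
  then show ?thesis
    unfolding has_xi_zeros_sum_def ps by (rule tendsto_of_real)
qed

lemma has_xi_zeros_sum_imp_eq: "has_xi_zeros_sum f S \<Longrightarrow> xi_zeros_sum f = S"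
  unfolding has_xi_zeros_sum_def xi_zeros_sum_def by (rule tendsto_Lim) simp_all

lemma xi_zeros_sum_cong:
  assumes "\<And>\<rho>. \<rho> \<in> xi_zeros \<Longrightarrow> f \<rho> = g \<rho>"
  shows "has_xi_zeros_sum f S \<longleftrightarrow> has_xi_zeros_sum g S"
proof -
  have "xi_zeros_partial_sum f = xi_zeros_partial_sum g"
    using assms by (auto simp: xi_zeros_partial_sum_def riemann_xi_eq xi_zeros_def intro!: ext sum.cong)
  then show ?thesis by (simp add: has_xi_zeros_sum_def)
qed

section \<open>The summands of the Li coefficients\<close>

text \<open>
  A Moebius transformation that maps the critical line to the unit circle, the point at infinity
  to \<open>1\<close>, and intertwines \<open>\<rho> \<mapsto> 1 - \<rho>\<close> with \<open>w \<mapsto> 1 / w\<close>.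
\<close>
definition li_base :: "real \<Rightarrow> complex \<Rightarrow> complex" where
  "li_base a \<rho> = (\<rho> - of_real a) / (\<rho> + of_real a - 1)"

lemma xi_zero_denominator: "\<rho> \<in> xi_zeros \<Longrightarrow> \<rho> + of_real a - 1 \<noteq> 0"
  using xi_zero_not_real[of \<rho>] by (auto simp: complex_eq_iff)

lemma li_base_alt:
  assumes "\<rho> \<in> xi_zeros"
  shows "li_base a \<rho> = 1 - (2 * of_real a - 1) / (\<rho> + of_real a - 1)"
  using xi_zero_denominator[OF assms, of a] by (simp add: li_base_def field_simps)

text \<open>
  A first-order expansion with a remainder whose growth in \<open>n\<close> is controlled by \<open>r\<close>: this
  \<open>r\<close> can be taken smaller than the maximal modulus when finitely many zeros are set aside.
\<close>
lemma one_minus_power_expansion: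
  fixes u :: complex
  assumes "norm (1 - u) \<le> r" "1 \<le> r"
  shows "norm (1 - (1 - u) ^ n - of_nat n * u) \<le> (real n)\<^sup>2 * (norm u)\<^sup>2 * r ^ n"
proof -
  have 1: "norm (1 - (1 - u) ^ n) \<le> real n * norm u * r ^ n" for n
  proof (induction n)
    case (Suc n)
    have "1 - (1 - u) ^ Suc n = (1 - (1 - u) ^ n) + u * (1 - u) ^ n" by (simp add: algebra_simps)
    then have "norm (1 - (1 - u) ^ Suc n) \<le> norm (1 - (1 - u) ^ n) + norm u * norm (1 - u) ^ n"
      by (metis norm_triangle_ineq norm_mult norm_power)
    also have "\<dots> \<le> real n * norm u * r ^ n + norm u * r ^ n"
      using assms by (intro add_mono Suc mult_left_mono power_mono) auto
    also have "\<dots> = real (Suc n) * norm u * r ^ n" by (simp add: algebra_simps)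
    also have "\<dots> \<le> real (Suc n) * norm u * r ^ Suc n"
      using assms by (intro mult_left_mono power_increasing) auto
    finally show ?case .
  qed simp
  show ?thesis
  proof (induction n)
    case (Suc n)
    have "1 - (1 - u) ^ Suc n - of_nat (Suc n) * u = (1 - (1 - u) ^ n - of_nat n * u) - u * (1 - (1 - u) ^ n)"
      by (simp add: algebra_simps)
    then have "norm (1 - (1 - u) ^ Suc n - of_nat (Suc n) * u) \<le> norm (1 - (1 - u) ^ n - of_nat n * u) + norm u * norm (1 - (1 - u) ^ n)"
      by (metis norm_triangle_ineq4 norm_mult)
    also have "\<dots> \<le> (real n)\<^sup>2 * (norm u)\<^sup>2 * r ^ n + norm u * (real n * norm u * r ^ n)"
      by (intro add_mono Suc mult_left_mono 1) auto
    also have "\<dots> = ((real n)\<^sup>2 + real n) * ((norm u)\<^sup>2 * r ^ n)" by (simp add: power2_eq_square algebra_simps)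
    also have "\<dots> \<le> (real (Suc n))\<^sup>2 * ((norm u)\<^sup>2 * r ^ Suc n)"
    proof (intro mult_mono)
      show "(real n)\<^sup>2 + real n \<le> (real (Suc n))\<^sup>2" by (simp add: power2_eq_square algebra_simps)
      show "r ^ n \<le> r ^ Suc n" using assms by (intro power_increasing) auto
    qed (use assms in auto)
    finally show ?case by (simp add: mult.assoc)
  qed simp
qed

text \<open>
  For large \<open>\<rho>\<close> the shift by \<open>a - 1\<close> is negligible; only finitely many zeros remain, and none of them
  annihilates the denominator.
\<close>
lemma xi_zero_denominator_bound:
  "\<exists>D>0. \<forall>\<rho>\<in>xi_zeros. 1 + norm \<rho> \<le> D * norm (\<rho> + of_real a - 1)"
proof -
  \<comment> \<open>Beyond this radius the shift is less than half of \<open>norm \<rho>\<close>.\<close>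
  define R where "R = 2 * \<bar>a - 1\<bar> + 1"
  define F where "F = {\<rho>\<in>xi_zeros. norm \<rho> \<le> R}"
  define ratio where "ratio \<rho> = (1 + norm \<rho>) / norm (\<rho> + of_real a - 1)" for \<rho> :: complex
  define D where "D = Max (insert 4 (ratio ` F))"
  have F: "finite F" unfolding F_def by (rule finite_xi_zeros_cball)
  have D4: "D \<ge> 4" unfolding D_def using F by (intro Max_ge) auto
  have "1 + norm \<rho> \<le> D * norm (\<rho> + of_real a - 1)" if \<rho>: "\<rho> \<in> xi_zeros" for \<rho>
  proof (cases "\<rho> \<in> F")
    case True
    then have "ratio \<rho> \<le> D" unfolding D_def using F by (intro Max_ge) auto
    then show ?thesis using xi_zero_denominator[OF \<rho>, of a] by (simp add: ratio_def field_simps)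
  next
    case False
    then have R: "norm \<rho> \<ge> 2 * \<bar>a - 1\<bar> + 1" using \<rho> by (simp add: F_def R_def)
    have "norm (\<rho> + of_real a - 1) \<ge> norm \<rho> - norm (of_real (a - 1) :: complex)"
      using norm_diff_ineq[of \<rho> "of_real (a - 1)"] by (simp add: add_diff_eq)
    then have "norm (\<rho> + of_real a - 1) \<ge> norm \<rho> - \<bar>a - 1\<bar>" by (simp only: norm_of_real)
    moreover have "1 + x \<le> 4 * y" if "x - A \<le> y" "2 * A + 1 \<le> x" "0 \<le> A" for x y A :: real
      using that by linarith
    ultimately have "1 + norm \<rho> \<le> 4 * norm (\<rho> + of_real a - 1)"
      using R by (metis abs_ge_zero)
    also have "\<dots> \<le> D * norm (\<rho> + of_real a - 1)" using D4 by (intro mult_right_mono) auto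
    finally show ?thesis .
  qed
  then show ?thesis using D4 by (intro exI[of _ D]) auto
qed

text \<open>
  The number \<open>1 - li_base a \<rho>\<close> is only of order \<open>1 / norm \<rho>\<close>. Its real part has the numerator
  \<open>(2 * a - 1) * Re (\<rho> + a - 1)\<close> over the squared modulus of the denominator, and this numerator is bounded
  because the zeros lie in a vertical strip.
\<close>
lemma li_base_bounds:
  "\<exists>C\<ge>0. \<forall>\<rho>\<in>xi_zeros. (norm (1 - li_base a \<rho>))\<^sup>2 \<le> C / (1 + norm \<rho>)\<^sup>2 \<and> \<bar>Re (1 - li_base a \<rho>)\<bar> \<le> C / (1 + norm \<rho>)\<^sup>2"
proof -
  obtain D where D: "D > 0" "\<And>\<rho>. \<rho> \<in> xi_zeros \<Longrightarrow> 1 + norm \<rho> \<le> D * norm (\<rho> + of_real a - 1)"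
    using xi_zero_denominator_bound[of a] by blast
  define c where "c = 2 * a - 1"
  define C where "C = (c\<^sup>2 + \<bar>c\<bar> * (3 + \<bar>a - 1\<bar>)) * D\<^sup>2"
  have "(norm (1 - li_base a \<rho>))\<^sup>2 \<le> C / (1 + norm \<rho>)\<^sup>2 \<and> \<bar>Re (1 - li_base a \<rho>)\<bar> \<le> C / (1 + norm \<rho>)\<^sup>2"
    if \<rho>: "\<rho> \<in> xi_zeros" for \<rho>
  proof -
    define d where "d = \<rho> + of_real a - 1"
    have d: "d \<noteq> 0" using xi_zero_denominator[OF \<rho>] by (simp add: d_def)
    have p: "(1 + norm \<rho>)\<^sup>2 > 0" using norm_ge_zero[of \<rho>] by (intro zero_less_power) linarith
    have "(1 + norm \<rho>)\<^sup>2 \<le> (D * norm d)\<^sup>2"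
      using D(2)[OF \<rho>] by (intro power_mono) (auto simp: d_def)
    then have inv: "1 / (norm d)\<^sup>2 \<le> D\<^sup>2 / (1 + norm \<rho>)\<^sup>2"
      using d p by (simp add: field_simps)
    have u: "1 - li_base a \<rho> = of_real c / d"
      unfolding li_base_alt[OF \<rho>] by (simp add: c_def d_def)
    have "(norm (1 - li_base a \<rho>))\<^sup>2 = c\<^sup>2 * (1 / (norm d)\<^sup>2)"
      by (simp add: u norm_divide power_divide)
    also have "\<dots> \<le> c\<^sup>2 * (D\<^sup>2 / (1 + norm \<rho>)\<^sup>2)" by (intro mult_left_mono inv) auto
    also have "\<dots> = c\<^sup>2 * D\<^sup>2 / (1 + norm \<rho>)\<^sup>2" by simp
    also have "\<dots> \<le> C / (1 + norm \<rho>)\<^sup>2" unfolding C_def by (intro divide_right_mono mult_right_mono) auto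
    finally have 1: "(norm (1 - li_base a \<rho>))\<^sup>2 \<le> C / (1 + norm \<rho>)\<^sup>2" .
    have "Re (1 - li_base a \<rho>) = c * Re d * (1 / (norm d)\<^sup>2)"
      unfolding u by (simp add: Re_divide cmod_power2)
    then have "\<bar>Re (1 - li_base a \<rho>)\<bar> = \<bar>c\<bar> * \<bar>Re d\<bar> * (1 / (norm d)\<^sup>2)" by (simp add: abs_mult)
    also have "\<dots> \<le> \<bar>c\<bar> * (3 + \<bar>a - 1\<bar>) * (D\<^sup>2 / (1 + norm \<rho>)\<^sup>2)"
    proof (intro mult_mono inv)
      have "\<bar>Re \<rho>\<bar> \<le> 3" using \<rho> theta_xi_zero_strip by (simp add: xi_zeros_def)
      then show "\<bar>Re d\<bar> \<le> 3 + \<bar>a - 1\<bar>" by (simp add: d_def)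
    qed auto
    also have "\<dots> = \<bar>c\<bar> * (3 + \<bar>a - 1\<bar>) * D\<^sup>2 / (1 + norm \<rho>)\<^sup>2" by simp
    also have "\<dots> \<le> C / (1 + norm \<rho>)\<^sup>2" unfolding C_def by (intro divide_right_mono mult_right_mono) auto
    finally show ?thesis using 1 by blast
  qed
  moreover have "C \<ge> 0" by (simp add: C_def)
  ultimately show ?thesis by blast
qed

lemma li_term_bound:
  "\<exists>C\<ge>0. \<forall>n r. \<forall>\<rho>\<in>xi_zeros. 1 \<le> r \<longrightarrow> norm (li_base a \<rho>) \<le> r \<longrightarrow>
     \<bar>Re (1 - li_base a \<rho> ^ n)\<bar> \<le> C * (real n)\<^sup>2 * r ^ n / (1 + norm \<rho>)\<^sup>2"
proof -
  obtain C where C: "C \<ge> 0" "\<And>\<rho>. \<rho> \<in> xi_zeros \<Longrightarrow> (norm (1 - li_base a \<rho>))\<^sup>2 \<le> C / (1 + norm \<rho>)\<^sup>2"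
     "\<And>\<rho>. \<rho> \<in> xi_zeros \<Longrightarrow> \<bar>Re (1 - li_base a \<rho>)\<bar> \<le> C / (1 + norm \<rho>)\<^sup>2"
    using li_base_bounds[of a] by blast
  have "\<bar>Re (1 - li_base a \<rho> ^ n)\<bar> \<le> 2 * C * (real n)\<^sup>2 * r ^ n / (1 + norm \<rho>)\<^sup>2"
    if \<rho>: "\<rho> \<in> xi_zeros" and r: "1 \<le> r" "norm (li_base a \<rho>) \<le> r" for n r \<rho>
  proof -
    define u where "u = 1 - li_base a \<rho>"
    define W where "W = C / (1 + norm \<rho>)\<^sup>2"
    have W: "W \<ge> 0" using C(1) by (simp add: W_def)
    have nn: "real n \<le> (real n)\<^sup>2 * r ^ n"
    proof (cases "n = 0")
      case False
      then have "real n * 1 \<le> real n * real n" by (intro mult_left_mono) auto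
      also have "\<dots> = (real n)\<^sup>2 * 1" by (simp add: power2_eq_square)
      also have "\<dots> \<le> (real n)\<^sup>2 * r ^ n" using r(1) by (intro mult_left_mono) auto
      finally show ?thesis by simp
    qed simp
    have e: "norm (1 - (1 - u) ^ n - of_nat n * u) \<le> (real n)\<^sup>2 * (norm u)\<^sup>2 * r ^ n"
      using r by (intro one_minus_power_expansion) (auto simp: u_def)
    define E where "E = 1 - (1 - u) ^ n - of_nat n * u"
    have "\<bar>Re (1 - (1 - u) ^ n)\<bar> = \<bar>Re E + real n * Re u\<bar>" by (simp add: E_def)
    also have "\<dots> \<le> \<bar>Re E\<bar> + \<bar>real n * Re u\<bar>" by (rule abs_triangle_ineq)
    also have "\<dots> \<le> norm E + real n * \<bar>Re u\<bar>"
      by (intro add_mono abs_Re_le_cmod) (simp add: abs_mult)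
    also have "\<dots> \<le> (real n)\<^sup>2 * W * r ^ n + ((real n)\<^sup>2 * r ^ n) * W"
    proof (intro add_mono)
      have "(real n)\<^sup>2 * (norm u)\<^sup>2 * r ^ n \<le> (real n)\<^sup>2 * W * r ^ n"
        using C(2)[OF \<rho>] r(1) unfolding u_def W_def by (intro mult_right_mono mult_left_mono) auto
      with e show "norm E \<le> (real n)\<^sup>2 * W * r ^ n" by (simp add: E_def)
      show "real n * \<bar>Re u\<bar> \<le> ((real n)\<^sup>2 * r ^ n) * W"
        using C(3)[OF \<rho>] nn r(1) unfolding u_def W_def by (intro mult_mono) auto
    qed
    also have "\<dots> = 2 * C * (real n)\<^sup>2 * r ^ n / (1 + norm \<rho>)\<^sup>2" by (simp add: W_def field_simps)
    finally show ?thesis by (simp add: u_def)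
  qed
  then show ?thesis using C(1) by (intro exI[of _ "2 * C"]) auto
qed

definition li_sum :: "real \<Rightarrow> nat \<Rightarrow> real" where
  "li_sum a n = (\<Sum>\<^sub>\<infinity>\<rho>\<in>xi_zeros. xi_mult \<rho> * Re (1 - li_base a \<rho> ^ n))"

lemma li_base_le: "\<exists>r\<ge>1. \<forall>\<rho>\<in>xi_zeros. norm (li_base a \<rho>) \<le> r"
proof -
  obtain C where C: "C \<ge> 0" "\<And>\<rho>. \<rho> \<in> xi_zeros \<Longrightarrow> (norm (1 - li_base a \<rho>))\<^sup>2 \<le> C / (1 + norm \<rho>)\<^sup>2"
    using li_base_bounds[of a] by blast
  have "norm (li_base a \<rho>) \<le> 1 + sqrt C" if "\<rho> \<in> xi_zeros" for \<rho>
  proof -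
    have p: "1 \<le> (1 + norm \<rho>)\<^sup>2" by (intro one_le_power) simp
    then have "C / (1 + norm \<rho>)\<^sup>2 \<le> C / 1"
      using C(1) by (intro divide_left_mono) linarith+
    then have "norm (1 - li_base a \<rho>) \<le> sqrt C" using C(2)[OF that] by (intro real_le_rsqrt) auto
    moreover have "norm (li_base a \<rho>) \<le> norm (1 :: complex) + norm (1 - li_base a \<rho>)"
      using norm_triangle_ineq4[of 1 "1 - li_base a \<rho>"] by simp
    ultimately show ?thesis by simp
  qed
  then show ?thesis using C(1) by (intro exI[of _ "1 + sqrt C"]) auto
qed

lemma li_summable: "(\<lambda>\<rho>. xi_mult \<rho> * Re (1 - li_base a \<rho> ^ n)) summable_on xi_zeros"
proof -
  obtain C where C: "C \<ge> 0" "\<And>n r \<rho>. \<rho> \<in> xi_zeros \<Longrightarrow> 1 \<le> r \<Longrightarrow> norm (li_base a \<rho>) \<le> r \<Longrightarrow>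
     \<bar>Re (1 - li_base a \<rho> ^ n)\<bar> \<le> C * (real n)\<^sup>2 * r ^ n / (1 + norm \<rho>)\<^sup>2"
    using li_term_bound[of a] by blast
  obtain r where r: "r \<ge> 1" "\<And>\<rho>. \<rho> \<in> xi_zeros \<Longrightarrow> norm (li_base a \<rho>) \<le> r"
    using li_base_le[of a] by blast
  have "(\<lambda>\<rho>. norm (xi_mult \<rho> * Re (1 - li_base a \<rho> ^ n))) summable_on xi_zeros"
  proof (rule summable_on_comparison_test)
    show "(\<lambda>\<rho>. C * (real n)\<^sup>2 * r ^ n * (xi_mult \<rho> / (1 + norm \<rho>)\<^sup>2)) summable_on xi_zeros"
      by (intro summable_on_cmult_right summable_xi_zeros)
    fix \<rho> assume \<rho>: "\<rho> \<in> xi_zeros"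
    have "xi_mult \<rho> * \<bar>Re (1 - li_base a \<rho> ^ n)\<bar> \<le> xi_mult \<rho> * (C * (real n)\<^sup>2 * r ^ n / (1 + norm \<rho>)\<^sup>2)"
      using C(2)[OF \<rho> r(1) r(2)[OF \<rho>]] xi_mult_nonneg by (rule mult_left_mono)
    then show "norm (xi_mult \<rho> * Re (1 - li_base a \<rho> ^ n)) \<le> C * (real n)\<^sup>2 * r ^ n * (xi_mult \<rho> / (1 + norm \<rho>)\<^sup>2)"
      by (simp add: abs_mult xi_mult_nonneg mult_ac)
  qed auto
  then show ?thesis by (rule abs_summable_summable)
qed

lemma li_has_sum: "has_xi_zeros_sum (\<lambda>\<rho>. 1 - li_base a \<rho> ^ n) (of_real (li_sum a n))"
  unfolding li_sum_def by (rule has_xi_zeros_sum_real[OF _ li_summable]) (simp add: li_base_def)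

lemma li_coeff_eq: "li_coeff n a = of_real (li_sum a n)"
  using has_xi_zeros_sum_imp_eq[OF li_has_sum[of a n]] unfolding li_coeff_def li_base_def .

text \<open>
  On the critical line \<open>\<rho> - a\<close> and \<open>\<rho> + a - 1\<close> are mirror images in the imaginary axis.
\<close>
lemma li_base_norm_critical:
  assumes "Re \<rho> = 1 / 2" "\<rho> + of_real a - 1 \<noteq> 0"
  shows "norm (li_base a \<rho>) = 1"
proof -
  have "\<rho> - of_real a = - cnj (\<rho> + of_real a - 1)" using assms(1) by (simp add: complex_eq_iff)
  then have "norm (\<rho> - of_real a) = norm (\<rho> + of_real a - 1)" by (metis complex_mod_cnj norm_minus_cancel)
  then show ?thesis using assms(2) by (simp add: li_base_def norm_divide)
qed

lemma li_sum_nonneg: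
  assumes "\<And>\<rho>. \<rho> \<in> xi_zeros \<Longrightarrow> Re \<rho> = 1 / 2"
  shows "li_sum a n \<ge> 0"
  unfolding li_sum_def
proof (rule infsum_nonneg)
  fix \<rho> assume \<rho>: "\<rho> \<in> xi_zeros"
  have "norm (li_base a \<rho>) = 1" using assms[OF \<rho>] xi_zero_denominator[OF \<rho>] by (rule li_base_norm_critical)
  then have "Re (li_base a \<rho> ^ n) \<le> 1"
    using complex_Re_le_cmod[of "li_base a \<rho> ^ n"] by (simp add: norm_power)
  then show "0 \<le> xi_mult \<rho> * Re (1 - li_base a \<rho> ^ n)" by (intro mult_nonneg_nonneg xi_mult_nonneg) simp
qed

section \<open>A zero off the critical line makes a coefficient negative\<close>

text \<open>
  Dirichlet's simultaneous approximation theorem makes the arguments of all \<open>w x ^ n\<close> close to multiples of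
  \<open>2 * pi\<close>.
\<close>
lemma simultaneous_alignment:
  fixes w :: "'a \<Rightarrow> complex"
  assumes M: "finite M"
  shows "\<exists>n\<ge>L. \<forall>x\<in>M. Re (w x ^ n) \<ge> norm (w x) ^ n / 2"
proof -
  obtain e where e: "bij_betw e {0..<card M} M" using ex_bij_betw_nat_finite[OF M] by blast
  \<comment> \<open>Approximating the multiples by \<open>L'\<close> of the angles makes \<open>n\<close> a positive multiple of \<open>L'\<close>, hence large.\<close>
  define L' where "L' = Suc L"
  define \<theta> where "\<theta> i = real L' * (Arg (w (e i)) / (2 * pi))" for i
  obtain q p where q: "0 < q" "\<And>i. i < card M \<Longrightarrow> \<bar>of_int q * \<theta> i - of_int (p i)\<bar> < 1 / real 6"
    by (rule Dirichlet_approx_simult[of 6 "card M" \<theta>]) auto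
  define n where "n = nat q * L'"
  have rq: "real (nat q) = of_int q" using q(1) by simp
  have "Re (w x ^ n) \<ge> norm (w x) ^ n / 2" if x: "x \<in> M" for x
  proof -
    have "x \<in> e ` {0..<card M}" using e x by (simp add: bij_betw_def)
    then obtain i where i: "i < card M" "e i = x" by auto
    \<comment> \<open>An error of at most a sixth of a turn keeps the cosine at least \<open>1 / 2\<close>.\<close>
    define t where "t = 2 * pi * (of_int q * \<theta> i - of_int (p i))"
    have "\<bar>t\<bar> = 2 * pi * \<bar>of_int q * \<theta> i - of_int (p i)\<bar>" by (simp add: t_def abs_mult)
    also have "\<dots> \<le> 2 * pi * (1 / 6)" using q(2)[OF i(1)] by (intro mult_left_mono) auto
    finally have "\<bar>t\<bar> \<le> pi / 3" by simp
    then have "cos (pi / 3) \<le> cos \<bar>t\<bar>" by (intro cos_monotone_0_pi_le) auto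
    then have ct: "cos t \<ge> 1 / 2" by (simp add: cos_60)
    have "real n * Arg (w x) = t + 2 * pi * of_int (p i)"
      using i rq by (simp add: t_def n_def \<theta>_def algebra_simps)
    then have "cos (real n * Arg (w x)) = cos t"
      using cos.plus_of_int[of t "p i"] by (simp add: mult_ac)
    moreover have "w x ^ n = rcis (norm (w x) ^ n) (real n * Arg (w x))"
      by (metis DeMoivre2 rcis_cmod_Arg)
    ultimately have "Re (w x ^ n) = norm (w x) ^ n * cos t" by simp
    also have "\<dots> \<ge> norm (w x) ^ n * (1 / 2)" using ct by (intro mult_left_mono) auto
    finally show ?thesis by simp
  qed
  moreover have "n \<ge> L"
  proof -
    have "1 * L' \<le> nat q * L'" using q(1) by (intro mult_right_mono) auto
    then show ?thesis by (simp add: n_def L'_def)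
  qed
  ultimately show ?thesis by blast
qed

text \<open>
  The difference of the squared moduli of numerator and denominator is
  \<open>(1 - 2 * a) * (2 * Re \<rho> - 1)\<close>, which changes sign under \<open>\<rho> \<mapsto> 1 - \<rho>\<close>.
\<close>
lemma li_base_off_line:
  assumes a: "a \<noteq> 1 / 2" and \<rho>: "\<rho> \<in> xi_zeros" "Re \<rho> \<noteq> 1 / 2"
  shows "\<exists>\<rho>\<in>xi_zeros. norm (li_base a \<rho>) > 1"
proof -
  have gt: "norm (li_base a \<sigma>) > 1" if "\<sigma> \<in> xi_zeros" "(1 - 2 * a) * (2 * Re \<sigma> - 1) > 0" for \<sigma>
  proof -
    have "(norm (\<sigma> - of_real a))\<^sup>2 - (norm (\<sigma> + of_real a - 1))\<^sup>2 = (1 - 2 * a) * (2 * Re \<sigma> - 1)"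
      unfolding cmod_power2 by (simp add: power2_eq_square algebra_simps)
    then have "(norm (\<sigma> + of_real a - 1))\<^sup>2 < (norm (\<sigma> - of_real a))\<^sup>2" using that(2) by linarith
    then have "norm (\<sigma> + of_real a - 1) < norm (\<sigma> - of_real a)" by (rule power2_less_imp_less) simp
    then show ?thesis
      using xi_zero_denominator[OF that(1), of a] by (simp add: li_base_def norm_divide)
  qed
  have "(1 - 2 * a) * (2 * Re \<rho> - 1) \<noteq> 0" using a \<rho>(2) by simp
  moreover have "(1 - 2 * a) * (2 * Re (1 - \<rho>) - 1) = - ((1 - 2 * a) * (2 * Re \<rho> - 1))" by (simp add: algebra_simps)
  ultimately consider "(1 - 2 * a) * (2 * Re \<rho> - 1) > 0" | "(1 - 2 * a) * (2 * Re (1 - \<rho>) - 1) > 0" by linarith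
  then show ?thesis
    using gt[of \<rho>] gt[of "1 - \<rho>"] \<rho>(1) xi_zeros_reflect[of \<rho>] by cases blast+
qed

text \<open>
  The base tends to \<open>1\<close> along the zeros.
\<close>
lemma finite_li_base_ge:
  assumes "\<delta> > 0"
  shows "finite {\<rho>\<in>xi_zeros. norm (li_base a \<rho>) \<ge> 1 + \<delta>}"
proof -
  obtain C where C: "C \<ge> 0" "\<And>\<rho>. \<rho> \<in> xi_zeros \<Longrightarrow> (norm (1 - li_base a \<rho>))\<^sup>2 \<le> C / (1 + norm \<rho>)\<^sup>2"
    using li_base_bounds[of a] by blast
  show ?thesis
  proof (rule finite_subset[OF _ finite_xi_zeros_cball[of "sqrt C / \<delta>"]], safe)
    fix \<rho> assume \<rho>: "\<rho> \<in> xi_zeros" "1 + \<delta> \<le> norm (li_base a \<rho>)"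
    have "norm (li_base a \<rho>) \<le> 1 + norm (1 - li_base a \<rho>)"
      using norm_triangle_ineq4[of 1 "1 - li_base a \<rho>"] by simp
    then have "\<delta> \<le> norm (1 - li_base a \<rho>)" using \<rho>(2) by linarith
    then have "\<delta>\<^sup>2 \<le> (norm (1 - li_base a \<rho>))\<^sup>2" using assms by (intro power_mono) auto
    also have "\<dots> \<le> C / (1 + norm \<rho>)\<^sup>2" by (rule C(2)[OF \<rho>(1)])
    finally have le: "\<delta>\<^sup>2 \<le> C / (1 + norm \<rho>)\<^sup>2" .
    have "1 \<le> (1 + norm \<rho>)\<^sup>2" by (intro one_le_power) simp
    then have "0 < (1 + norm \<rho>)\<^sup>2" by linarith
    from pos_le_divide_eq[OF this, THEN iffD1, OF le] have "\<delta>\<^sup>2 * (1 + norm \<rho>)\<^sup>2 \<le> C" .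
    then have "(\<delta> * (1 + norm \<rho>))\<^sup>2 \<le> C" by (simp add: power_mult_distrib)
    then have "\<delta> * (1 + norm \<rho>) \<le> sqrt C" by (rule real_le_rsqrt)
    then have "1 + norm \<rho> \<le> sqrt C / \<delta>" using assms by (simp add: field_simps)
    then show "norm \<rho> \<le> sqrt C / \<delta>" by simp
  qed
qed

lemma power2_times_power_tendsto_0:
  assumes "0 \<le> x" "x < (1::real)"
  shows "(\<lambda>n. (real n)\<^sup>2 * x ^ n) \<longlonglongrightarrow> 0"
proof -
  have "(\<lambda>n. of_nat n * sqrt x ^ n) \<longlonglongrightarrow> 0"
    using assms by (intro powser_times_n_limit_0) (simp add: real_sqrt_lt_1_iff)
  then have "(\<lambda>n. (of_nat n * sqrt x ^ n)\<^sup>2) \<longlonglongrightarrow> 0\<^sup>2" by (rule tendsto_power)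
  moreover have "(sqrt x ^ n)\<^sup>2 = x ^ n" for n
  proof -
    have "(sqrt x ^ n)\<^sup>2 = ((sqrt x)\<^sup>2) ^ n" by (simp only: power_mult[symmetric] mult.commute)
    then show ?thesis using assms by simp
  qed
  ultimately show ?thesis by (simp add: power_mult_distrib)
qed

text \<open>
  Since all but finitely many bases lie close to \<open>1\<close>, the moduli have a maximum \<open>R\<close> as soon as one of them
  exceeds \<open>1\<close>, it is attained finitely often, and there is a gap below it.
\<close>
lemma li_base_maximal_zeros:
  assumes "\<rho>0 \<in> xi_zeros" "norm (li_base a \<rho>0) > 1"
  shows "\<exists>r R M. 1 < r \<and> r < R \<and> finite M \<and> M \<noteq> {} \<and> M \<subseteq> xi_zeros \<and>
    (\<forall>\<rho>\<in>M. norm (li_base a \<rho>) = R) \<and> (\<forall>\<rho>\<in>xi_zeros - M. norm (li_base a \<rho>) \<le> r)"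
proof -
  let ?w = "\<lambda>\<rho>. norm (li_base a \<rho>)"
  define A where "A = {\<rho>\<in>xi_zeros. ?w \<rho> \<ge> ?w \<rho>0}"
  have A: "finite A" "\<rho>0 \<in> A"
    using finite_li_base_ge[of "?w \<rho>0 - 1" a] assms by (auto simp: A_def)
  define R where "R = Max (?w ` A)"
  have R0: "R \<ge> ?w \<rho>0" unfolding R_def using A by (intro Max_ge) auto
  have Rle: "?w \<rho> \<le> R" if "\<rho> \<in> xi_zeros" for \<rho>
  proof (cases "\<rho> \<in> A")
    case True
    then show ?thesis unfolding R_def using A by (intro Max_ge) auto
  next
    case False
    then show ?thesis using that R0 by (auto simp: A_def)
  qed
  have R1: "R > 1" using R0 assms(2) by linarith
  have "R \<in> ?w ` A" unfolding R_def using A by (intro Max_in) auto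
  define M where "M = {\<rho>\<in>A. ?w \<rho> = R}"
  \<comment> \<open>Only finitely many moduli exceed \<open>q > 1\<close>; \<open>r\<close> is the largest of them below \<open>R\<close>, or \<open>q\<close>.\<close>
  define q where "q = (1 + R) / 2"
  define B where "B = {\<rho>\<in>xi_zeros. ?w \<rho> \<ge> q \<and> ?w \<rho> < R}"
  have q: "1 < q" "q < R" using R1 by (auto simp: q_def)
  have B: "finite B"
    using finite_subset[OF _ finite_li_base_ge[of "q - 1" a], of B] q by (auto simp: B_def)
  define r where "r = Max (insert q (?w ` B))"
  show ?thesis
  proof (rule exI[of _ r], rule exI[of _ R], rule exI[of _ M], intro conjI ballI)
    have "q \<le> r" unfolding r_def using B by (intro Max_ge) auto
    then show "1 < r" using q by linarith
    have "r \<in> insert q (?w ` B)" unfolding r_def using B by (intro Max_in) auto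
    then show "r < R" using q by (auto simp: B_def)
    show "finite M" using A(1) by (simp add: M_def)
    show "M \<subseteq> xi_zeros" by (auto simp: M_def A_def)
    show "M \<noteq> {}" using \<open>R \<in> ?w ` A\<close> by (auto simp: M_def)
    show "?w \<rho> = R" if "\<rho> \<in> M" for \<rho> using that by (simp add: M_def)
    fix \<rho> assume \<rho>: "\<rho> \<in> xi_zeros - M"
    have "?w \<rho> \<noteq> R" using \<rho> R0 by (auto simp: M_def A_def)
    then have lt: "?w \<rho> < R" using Rle[of \<rho>] \<rho> by simp
    show "?w \<rho> \<le> r"
    proof (cases "?w \<rho> \<ge> q")
      case True
      then have "\<rho> \<in> B" using \<rho> lt by (simp add: B_def)
      then show ?thesis unfolding r_def using B by (intro Max_ge) auto
    next
      case False
      then show ?thesis using \<open>q \<le> r\<close> by linarith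
    qed
  qed
qed

text \<open>
  Along the exponents of simultaneous alignment, the finitely many zeros of maximal modulus contribute at
  most \<open>\<mu> * (1 - R ^ n / 2)\<close>, where \<open>\<mu>\<close> is their total multiplicity. The contribution of all other zeros is
  of order \<open>n\<^sup>2 * r ^ n\<close> with \<open>r < R\<close> and cannot compensate for this.
\<close>
lemma li_sum_negative:
  assumes "\<rho>0 \<in> xi_zeros" "norm (li_base a \<rho>0) > 1"
  shows "\<exists>n. li_sum a n < 0"
proof -
  let ?w = "li_base a"
  obtain R r M where r: "1 < r" "r < R" and M: "finite M" "M \<noteq> {}" "M \<subseteq> xi_zeros"
    and wM: "\<And>\<rho>. \<rho> \<in> M \<Longrightarrow> norm (?w \<rho>) = R" and wr: "\<And>\<rho>. \<rho> \<in> xi_zeros - M \<Longrightarrow> norm (?w \<rho>) \<le> r"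
    using li_base_maximal_zeros[OF assms] by blast
  obtain C where C: "C \<ge> 0" "\<And>n r \<rho>. \<rho> \<in> xi_zeros \<Longrightarrow> 1 \<le> r \<Longrightarrow> norm (?w \<rho>) \<le> r \<Longrightarrow>
     \<bar>Re (1 - ?w \<rho> ^ n)\<bar> \<le> C * (real n)\<^sup>2 * r ^ n / (1 + norm \<rho>)\<^sup>2"
    using li_term_bound[of a] by blast
  define \<mu> where "\<mu> = (\<Sum>\<rho>\<in>M. xi_mult \<rho>)"
  define W where "W = (\<Sum>\<^sub>\<infinity>\<rho>\<in>xi_zeros. xi_mult \<rho> / (1 + norm \<rho>)\<^sup>2)"
  have \<mu>: "\<mu> > 0"
    unfolding \<mu>_def using M xi_mult_ge_1 by (intro sum_pos) (auto intro: less_le_trans[OF zero_less_one])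
  \<comment> \<open>The upper bound for \<open>li_sum a n\<close> divided by \<open>R ^ n\<close>; it tends to \<open>- \<mu> / 2\<close>.\<close>
  define G where "G n = \<mu> * (1 / R) ^ n - \<mu> / 2 + C * W * ((real n)\<^sup>2 * (r / R) ^ n)" for n
  have "G \<longlonglongrightarrow> \<mu> * 0 - \<mu> / 2 + C * W * 0"
    unfolding G_def using r
    by (intro tendsto_intros LIMSEQ_power_zero power2_times_power_tendsto_0) auto
  then have "\<forall>\<^sub>F n in sequentially. G n < 0"
    using \<mu> by (intro order_tendstoD(2)) auto
  then obtain L where L: "\<And>n. n \<ge> L \<Longrightarrow> G n < 0" by (auto simp: eventually_sequentially)
  obtain n where n: "n \<ge> L" "\<And>\<rho>. \<rho> \<in> M \<Longrightarrow> Re (?w \<rho> ^ n) \<ge> norm (?w \<rho>) ^ n / 2"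
    using simultaneous_alignment[OF M(1), of L ?w] by blast
  let ?g = "\<lambda>\<rho>. xi_mult \<rho> * Re (1 - ?w \<rho> ^ n)"
  have sub: "?g summable_on X" if "X \<subseteq> xi_zeros" for X
    using li_summable[of a n] that by (rule summable_on_subset_banach)
  have "li_sum a n = infsum ?g (M \<union> (xi_zeros - M))"
    unfolding li_sum_def using M(3) by (simp add: Un_absorb1)
  also have "\<dots> = infsum ?g M + infsum ?g (xi_zeros - M)"
    using M(3) by (intro infsum_Un_disjoint sub) auto
  also have "infsum ?g M = (\<Sum>\<rho>\<in>M. ?g \<rho>)" using M(1) by simp
  also have "\<dots> \<le> (\<Sum>\<rho>\<in>M. xi_mult \<rho> * (1 - R ^ n / 2))"
  proof (intro sum_mono mult_left_mono xi_mult_nonneg)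
    fix \<rho> assume "\<rho> \<in> M"
    then show "Re (1 - ?w \<rho> ^ n) \<le> 1 - R ^ n / 2" using n(2) wM by simp
  qed
  also have "\<dots> = \<mu> * (1 - R ^ n / 2)" by (simp add: \<mu>_def sum_distrib_right)
  also have "infsum ?g (xi_zeros - M) \<le> (\<Sum>\<^sub>\<infinity>\<rho>\<in>xi_zeros. C * (real n)\<^sup>2 * r ^ n * (xi_mult \<rho> / (1 + norm \<rho>)\<^sup>2))"
  proof (rule infsum_mono_neutral)
    show "?g summable_on xi_zeros - M" by (rule sub) auto
    show "(\<lambda>\<rho>. C * (real n)\<^sup>2 * r ^ n * (xi_mult \<rho> / (1 + norm \<rho>)\<^sup>2)) summable_on xi_zeros"
      by (intro summable_on_cmult_right summable_xi_zeros)
    show "?g \<rho> \<le> C * (real n)\<^sup>2 * r ^ n * (xi_mult \<rho> / (1 + norm \<rho>)\<^sup>2)" if "\<rho> \<in> (xi_zeros - M) \<inter> xi_zeros" for \<rho>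
    proof -
      have "\<bar>Re (1 - ?w \<rho> ^ n)\<bar> \<le> C * (real n)\<^sup>2 * r ^ n / (1 + norm \<rho>)\<^sup>2"
        using that r wr by (intro C(2)) auto
      then have "Re (1 - ?w \<rho> ^ n) \<le> C * (real n)\<^sup>2 * r ^ n / (1 + norm \<rho>)\<^sup>2" by (rule order_trans[OF abs_ge_self])
      from mult_left_mono[OF this xi_mult_nonneg[of \<rho>]] show ?thesis by (simp add: mult_ac)
    qed
    show "0 \<le> C * (real n)\<^sup>2 * r ^ n * (xi_mult \<rho> / (1 + norm \<rho>)\<^sup>2)" for \<rho>
      using C(1) r(1) by (intro mult_nonneg_nonneg divide_nonneg_nonneg xi_mult_nonneg) auto
  qed auto
  also have "\<dots> = C * (real n)\<^sup>2 * r ^ n * W"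
    unfolding W_def by (rule infsum_cmult_right) (rule summable_xi_zeros)
  finally have "li_sum a n \<le> \<mu> * (1 - R ^ n / 2) + C * (real n)\<^sup>2 * r ^ n * W" by simp
  also have "\<dots> = R ^ n * G n"
    using r by (simp add: G_def power_divide field_simps)
  also have "\<dots> < 0" using L[OF n(1)] r by (intro mult_pos_neg) auto
  finally show ?thesis by blast
qed

theorem theorem1:
  fixes a :: real
  assumes "a \<noteq> 1 / 2"
  shows "(\<forall>n::nat.
            has_xi_zeros_sum (\<lambda>\<rho>. 1 - ((\<rho> - of_real a) / (\<rho> + of_real a - 1)) ^ n)
              (li_coeff n a) \<and>
            has_xi_zeros_sum (\<lambda>\<rho>. 1 - (1 - (2 * of_real a - 1) / (\<rho> + of_real a - 1)) ^ n)
              (li_coeff n a)) \<and>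
         (riemann_hypothesis \<longleftrightarrow> (\<forall>n::nat. 0 \<le> li_coeff n a))"
proof (intro conjI allI)
  fix n :: nat
  show "has_xi_zeros_sum (\<lambda>\<rho>. 1 - ((\<rho> - of_real a) / (\<rho> + of_real a - 1)) ^ n) (li_coeff n a)"
    using li_has_sum[of a n] unfolding li_coeff_eq li_base_def .
  have "has_xi_zeros_sum (\<lambda>\<rho>. 1 - (1 - (2 * of_real a - 1) / (\<rho> + of_real a - 1)) ^ n) (li_coeff n a)
      \<longleftrightarrow> has_xi_zeros_sum (\<lambda>\<rho>. 1 - li_base a \<rho> ^ n) (li_coeff n a)"
    by (rule xi_zeros_sum_cong) (simp add: li_base_alt)
  then show "has_xi_zeros_sum (\<lambda>\<rho>. 1 - (1 - (2 * of_real a - 1) / (\<rho> + of_real a - 1)) ^ n) (li_coeff n a)"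
    using li_has_sum[of a n] unfolding li_coeff_eq by blast
next
  have RH: "riemann_hypothesis \<longleftrightarrow> (\<forall>\<rho>\<in>xi_zeros. Re \<rho> = 1 / 2)"
    by (auto simp: riemann_hypothesis_def riemann_xi_eq xi_zeros_def)
  have nonneg: "0 \<le> li_coeff n a \<longleftrightarrow> 0 \<le> li_sum a n" for n
    by (simp add: li_coeff_eq less_eq_complex_def)
  show "riemann_hypothesis \<longleftrightarrow> (\<forall>n::nat. 0 \<le> li_coeff n a)"
    unfolding RH nonneg
  proof (intro iffI allI ballI)
    fix n assume "\<forall>\<rho>\<in>xi_zeros. Re \<rho> = 1 / 2"
    then show "0 \<le> li_sum a n" by (intro li_sum_nonneg) blast
  next
    fix \<rho> assume pos: "\<forall>n. 0 \<le> li_sum a n" and \<rho>: "\<rho> \<in> xi_zeros"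
    show "Re \<rho> = 1 / 2"
    proof (rule ccontr)
      assume "Re \<rho> \<noteq> 1 / 2"
      with assms \<rho> obtain \<sigma> where "\<sigma> \<in> xi_zeros" "norm (li_base a \<sigma>) > 1"
        using li_base_off_line by blast
      then obtain n where "li_sum a n < 0" using li_sum_negative by blast
      with pos show False by (meson not_less)
    qed
  qed
qed

end
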